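(* Let $(\mathbf{A},\mathbf{B})$ be a pair of random real $N\times N$ matrices, with i.i.d. copies $(\mathbf{A}_n,\mathbf{B}_n)_{n\ge1}$, such that $$\mathbb{E}\left[\log^+\left(\lambda_{\max}(\mathbf{A}\mathbf{A}^\top)\right)\right]<+\infty,\qquad \mathbb{E}\left[\log^+\left(\lambda_{\max}(\mathbf{B}\mathbf{B}^\top)\right)\right]<+\infty,$$ $$\gamma:=\inf_{n\ge1}\frac1n\,\mathbb{E}\left[\log\left(\lambda_{\max}\left(\mathbf{A}_1\cdots\mathbf{A}_n\mathbf{A}_n^\top\cdots\mathbf{A}_1^\top\right)\right)\right]<0,$$ and such that $(\mathbf{u}\mathbf{A}\mathbf{A}^\top\mathbf{u}^\top,\mathbf{u}\mathbf{B}\mathbf{u}^\top)\stackrel{d}{=}(\mathbf{A}\mathbf{A}^\top,\mathbf{B})$ for every orthogonal $N\times N$ matrix $\mathbf{u}$. Let $\mathbf{X}$ be the unique (in law) solution to $\mathbf{X}\stackrel{d}{=}\mathbf{A}\mathbf{X}\mathbf{A}^\top+\mathbf{B}$ with $(\mathbf{A},\mathbf{B})$ and $\mathbf{X}$ independent. Then for any $1\le k\le N$, $$\mathbf{X}^{[k]}\stackrel{d}{=}\left((\mathbf{A}\mathbf{A}^\top)^{[k]}\right)^{1/2}\mathbf{X}^{[k]}\left((\mathbf{A}\mathbf{A}^\top)^{[k]}\right)^{1/2}+\mathbf{B}^{[k]},\qquad \left((\mathbf{A}\mathbf{A}^\top)^{[k]},\mathbf{B}^{[k]}\right)\text{ and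 }\mathbf{X}^{[k]}\text{ independent}.$$ In particular, $$\mathbf{X}_{11}\stackrel{d}{=}(\mathbf{A}\mathbf{A}^\top)_{11}\,\mathbf{X}_{11}+\mathbf{B}_{11},\qquad \left((\mathbf{A}\mathbf{A}^\top)_{11},\mathbf{B}_{11}\right)\text{ and }\mathbf{X}_{11}\text{ independent}.$$
   Context: For an $N\times N$ matrix $\mathbf{x}$, $\mathbf{x}^{[k]}=(\mathbf{x}_{ij})_{i,j\le k}$ is its $k\times k$ leading principal submatrix. $\lambda_{\max}$ is the largest eigenvalue of a symmetric matrix; $(\cdot)^{1/2}$ is the positive semidefinite square root; $\log^+(a)=\max\{\log a,0\}$ (with $\log^+0=0$, $\log0=-\infty$). $\stackrel{d}{=}$ denotes equality in distribution. Under the first three displayed conditions (log-moments and $\gamma<0$) the equation $\mathbf{X}\stackrel{d}{=}\mathbf{A}\mathbf{X}\mathbf{A}^\top+\mathbf{B}$ is known to have a solution that is unique in law. *)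

theory Defs
  imports "HOL-Probability.Probability"
begin

text \<open>
  An \<open>N \<times> N\<close> matrix has type \<open>real^'n^'n\<close> with \<open>N = CARD('n)\<close>. The class \<open>linorder\<close> on the
  index type makes ``leading'' meaningful: the indices \<open>1 < \<dots> < N\<close> are the elements of \<open>'n\<close> in
  increasing order. A \<open>k \<times> k\<close> matrix is indexed by a second such type \<open>'k\<close>.
\<close>
type_synonym 'n sqmat = "((real, 'n) vec, 'n) vec"

text \<open>
  The element of \<open>'n\<close> in the same position as \<open>i\<close>, counting from the smallest element.
  It exists for every \<open>i\<close> only if \<open>CARD('k) \<le> CARD('n)\<close>; see the lemmas below.
\<close>
definition lead_idx :: "'k::{finite,linorder} \<Rightarrow> 'n::{finite,linorder}" where
  "lead_idx i = (THE j. card {..<j} = card {..<i})"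

lemma card_lessThan_less_iff:
  fixes i j :: "'n::{finite,linorder}"
  shows "card {..<i} < card {..<j} \<longleftrightarrow> i < j"
proof -
  have *: "card {..<a} < card {..<b}" if "a < b" for a b :: 'n
    using that by (intro psubset_card_mono) auto
  show ?thesis
    using *[of i j] *[of j i] by (metis less_asym linorder_neqE less_irrefl)
qed

lemma bij_betw_card_lessThan:
  "bij_betw (\<lambda>j::'n::{finite,linorder}. card {..<j}) UNIV {..<CARD('n)}"
proof -
  have inj: "inj (\<lambda>j::'n. card {..<j})"
    by (rule injI) (metis card_lessThan_less_iff less_irrefl linorder_cases)
  have "range (\<lambda>j::'n. card {..<j}) \<subseteq> {..<CARD('n)}"
    by (auto intro!: psubset_card_mono)
  hence "range (\<lambda>j::'n. card {..<j}) = {..<CARD('n)}"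
    using inj by (intro card_subset_eq) (auto simp: card_image)
  thus ?thesis using inj by (simp add: bij_betw_def)
qed

lemma card_lessThan_lead_idx:
  fixes i :: "'k::{finite,linorder}"
  assumes "CARD('k) \<le> CARD('n)"
  shows "card {..<(lead_idx i :: 'n::{finite,linorder})} = card {..<i}"
proof -
  have "card {..<i} < CARD('n)"
    by (rule less_le_trans[OF _ assms]) (auto intro!: psubset_card_mono)
  hence "card {..<i} \<in> range (\<lambda>j::'n. card {..<j})"
    using bij_betw_card_lessThan[where 'n='n] by (simp add: bij_betw_def)
  then obtain j :: 'n where j: "card {..<j} = card {..<i}"
    by auto
  have "j' = j" if "card {..<j'} = card {..<i}" for j' :: 'n
    using that j by (metis card_lessThan_less_iff less_irrefl linorder_cases)
  thus ?thesis unfolding lead_idx_def using j by (rule_tac theI) auto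
qed

lemma strict_mono_lead_idx:
  assumes "CARD('k) \<le> CARD('n)"
  shows "strict_mono (lead_idx :: 'k::{finite,linorder} \<Rightarrow> 'n::{finite,linorder})"
  using card_lessThan_lead_idx[OF assms]
  by (auto intro!: strict_monoI simp flip: card_lessThan_less_iff)

lemma range_lead_idx:
  assumes "CARD('k) \<le> CARD('n)"
  shows "range (lead_idx :: 'k::{finite,linorder} \<Rightarrow> 'n::{finite,linorder})
           = {j. card {..<j} < CARD('k)}"
proof (intro equalityI subsetI)
  fix j :: 'n assume "j \<in> range (lead_idx :: 'k \<Rightarrow> 'n)"
  thus "j \<in> {j. card {..<j} < CARD('k)}"
    using card_lessThan_lead_idx[OF assms] bij_betw_card_lessThan[where 'n='k]
    by (force simp: bij_betw_def)
next
  fix j :: 'n assume "j \<in> {j. card {..<j} < CARD('k)}"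
  hence "card {..<j} \<in> range (\<lambda>i::'k. card {..<i})"
    using bij_betw_card_lessThan[where 'n='k] by (simp add: bij_betw_def)
  then obtain i :: 'k where "card {..<i} = card {..<j}"
    by auto
  hence "lead_idx i = j"
    using card_lessThan_lead_idx[OF assms, of i]
    by (metis card_lessThan_less_iff less_irrefl linorder_cases)
  thus "j \<in> range (lead_idx :: 'k \<Rightarrow> 'n)" by blast
qed

definition leading_submatrix ::
    "'n::{finite,linorder} sqmat \<Rightarrow> 'k::{finite,linorder} sqmat" where
  "leading_submatrix x = (\<chi> i j. x $ lead_idx i $ lead_idx j)"

definition entry11 :: "'n::{finite,linorder} sqmat \<Rightarrow> real" where
  "entry11 x = x $ Min UNIV $ Min UNIV"

definition mat_eigenvalues :: "real^'n^'n \<Rightarrow> real set" where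
  "mat_eigenvalues S = {c. \<exists>v. v \<noteq> 0 \<and> S *v v = c *\<^sub>R v}"

text \<open>Meant for symmetric \<open>S\<close>, whose set of real eigenvalues is finite and nonempty.\<close>
definition lambda_max :: "real^'n^'n \<Rightarrow> real" where
  "lambda_max S = Max (mat_eigenvalues S)"

definition pos_semidef :: "real^'n^'n \<Rightarrow> bool" where
  "pos_semidef S \<longleftrightarrow> transpose S = S \<and> (\<forall>v. 0 \<le> v \<bullet> (S *v v))"

text \<open>Meant for positive semidefinite \<open>S\<close>, for which such an \<open>R\<close> exists and is unique.\<close>
definition psd_sqrt :: "real^'n^'n \<Rightarrow> real^'n^'n" where
  "psd_sqrt S = (THE R. pos_semidef R \<and> R ** R = S)"

text \<open>\<open>mat_prod F n = F 1 ** F 2 ** \<dots> ** F n\<close>; the value \<open>F 0\<close> is not used.\<close>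
primrec mat_prod :: "(nat \<Rightarrow> real^'n^'n) \<Rightarrow> nat \<Rightarrow> real^'n^'n" where
  "mat_prod F 0 = mat 1"
| "mat_prod F (Suc n) = mat_prod F n ** F (Suc n)"

text \<open>
  The logarithm on \<open>[0, \<infinity>)\<close> with \<open>log 0 = -\<infinity>\<close>, which \<^const>\<open>ln\<close> does not provide. Negative
  arguments do not occur.
\<close>
definition elog :: "real \<Rightarrow> ereal" where
  "elog a = (if a \<le> 0 then - \<infinity> else ereal (ln a))"

definition elog_plus :: "real \<Rightarrow> ereal" where
  "elog_plus a = max (elog a) 0"

text \<open>
  \<open>E f = E f\<^sup>+ - E f\<^sup>-\<close> with values in \<open>[-\<infinity>, \<infinity>]\<close>; the conversion \<^const>\<open>e2ennreal\<close> truncates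
  negative values to \<open>0\<close>. If both parts are infinite the value is \<open>\<infinity>\<close>.
\<close>
definition eexpectation :: "'a measure \<Rightarrow> ('a \<Rightarrow> ereal) \<Rightarrow> ereal" where
  "eexpectation M f =
     enn2ereal (\<integral>\<^sup>+ \<omega>. e2ennreal (f \<omega>) \<partial>M) - enn2ereal (\<integral>\<^sup>+ \<omega>. e2ennreal (- f \<omega>) \<partial>M)"

definition lyapunov :: "'a measure \<Rightarrow> (nat \<Rightarrow> 'a \<Rightarrow> real^'n^'n) \<Rightarrow> ereal" where
  "lyapunov M F =
     (INF n\<in>{1..}. ereal (1 / real n) *
        eexpectation M (\<lambda>\<omega>. elog (lambda_max
          (mat_prod (\<lambda>m. F m \<omega>) n ** transpose (mat_prod (\<lambda>m. F m \<omega>) n)))))"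

definition eq_distr :: "'a measure \<Rightarrow> ('a \<Rightarrow> 'b::topological_space) \<Rightarrow> ('a \<Rightarrow> 'b) \<Rightarrow> bool" where
  "eq_distr M Y Z \<longleftrightarrow> distr M borel Y = distr M borel Z"

text \<open>
  \<^const>\<open>prob_space.indep_var\<close> forces both random variables to have the same value type. This is
  its definition for two different value types; see \<open>indep_rv_iff_indep_var\<close>.
\<close>
definition indep_rv ::
    "'a measure \<Rightarrow> ('a \<Rightarrow> 'b::topological_space) \<Rightarrow> ('a \<Rightarrow> 'c::topological_space) \<Rightarrow> bool" where
  "indep_rv M Y Z \<longleftrightarrow>
     Y \<in> borel_measurable M \<and> Z \<in> borel_measurable M \<and>
     prob_space.indep_set M
       {Y -` S \<inter> space M | S. S \<in> sets borel} {Z -` S \<inter> space M | S. S \<in> sets borel}"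

lemma indep_rv_iff_indep_var:
  assumes "prob_space M"
  shows "indep_rv M Y Z \<longleftrightarrow> prob_space.indep_var M borel Y borel Z"
proof -
  interpret prob_space M by fact
  have "case_bool {Y -` S \<inter> space M | S. S \<in> sets borel} {Z -` S \<inter> space M | S. S \<in> sets borel} =
          (\<lambda>i. {case_bool Y Z i -` S \<inter> space M | S. S \<in> sets (case_bool borel borel i)})"
    by (auto simp: fun_eq_iff split: bool.split)
  thus ?thesis
    unfolding indep_rv_def indep_var_def indep_vars_def2 indep_set_def
    by (auto simp: all_bool_eq)
qed

end

theory Submission
  imports Defs
begin

text \<open>
  Suppose that the law of \<open>X\<close> is orthogonally invariant: \<open>u X u\<^sup>T\<close> has the law of \<open>X\<close> for every
  orthogonal \<open>u\<close>. Let \<open>J\<close> be the \<open>k \<times> N\<close> matrix that selects the leading coordinates, so that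
  \<open>J Y J\<^sup>T\<close> is the leading submatrix of \<open>Y\<close>, and let \<open>S = J A A\<^sup>T J\<^sup>T\<close>. The matrices \<open>J A\<close> and
  \<open>S\<^sup>1\<^sup>/\<^sup>2 J\<close> have the same Gram matrix \<open>S\<close>, hence \<open>J A = S\<^sup>1\<^sup>/\<^sup>2 J U\<close> for an orthogonal \<open>U\<close> that
  depends on \<open>A\<close> only (\<open>equal_gram_matrices\<close>). As \<open>X\<close> is independent of \<open>(A, B)\<close>, the matrix
  \<open>U X U\<^sup>T\<close> has the law of \<open>X\<close> even when \<open>(A, B)\<close> is given, so
  \<open>J X J\<^sup>T \<sim> (J A) X (J A)\<^sup>T + J B J\<^sup>T \<sim> S\<^sup>1\<^sup>/\<^sup>2 (J X J\<^sup>T) S\<^sup>1\<^sup>/\<^sup>2 + J B J\<^sup>T\<close>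
  (\<open>fixed_point_compression\<close>). The entry in the first row and column is the case \<open>k = 1\<close>.

  It remains to see that the law of \<open>X\<close> is invariant (\<open>orth_invariant_fixed_point\<close>). The hypothesis
  is an invariance of \<open>(A A\<^sup>T, B)\<close> and not of \<open>(A, B)\<close>, so \<open>u X u\<^sup>T\<close> need not visibly solve the same
  equation. But the map \<open>\<nu> \<mapsto> law of A Z A\<^sup>T + B\<close>, with \<open>Z\<close> of law \<open>\<nu>\<close> independent of \<open>(A, B)\<close>, preserves
  invariance (\<open>orth_invariant_affine_push\<close>), again because for invariant \<open>\<nu>\<close> the law of \<open>a Z a\<^sup>T\<close> depends
  on \<open>a a\<^sup>T\<close> only. Iterating it from the point mass at \<open>0\<close> gives invariant laws. They come
  arbitrarily close to the law of \<open>X\<close>: running the same random maps from \<open>X\<close> and from \<open>0\<close> gives the difference \<open>c X c\<^sup>T\<close> with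
  \<open>c\<close> a product of \<open>n\<close> independent copies of \<open>A\<close>, and for suitable \<open>n\<close> such a product is small with
  probability close to \<open>1\<close> (\<open>affine_push_near_orbit_of_0\<close>).

  The last claim is where the negative Lyapunov exponent enters (\<open>negative_lyapunov_contracts\<close>). For
  some \<open>n\<close> the logarithm of the squared norm of a product of \<open>n\<close> factors has negative expectation; cut
  off from below it becomes an integrable variable \<open>Y\<close> of negative mean. The logarithm of the squared
  norm of a product of \<open>m\<close> blocks is at most a sum of \<open>m\<close> independent copies of \<open>Y\<close>, which tends to
  \<open>-\<infinity>\<close> in probability. Only first moments are available, so this is proved by a Chernoff bound for the
  variables cut off at level \<open>m\<close>, with exponent proportional to \<open>1 / m\<close>
  (\<open>affine_power_tail_bound\<close>, \<open>truncated_chernoff_limit\<close>).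
\<close>

section \<open>Eigenvectors of symmetric matrices\<close>

lemma inner_matrix_vector_transpose:
  fixes A :: "real^'n^'m"
  shows "x \<bullet> (A *v y) = (transpose A *v x) \<bullet> y"
  by (metis dot_lmul_matrix transpose_matrix_vector)

text \<open>
  The subspace \<open>W\<close> is there so that the lemma can be applied to an orthogonal complement, which
  is how the eigenbasis below is built. If the unit vector \<open>v\<close> maximizes the quadratic form with
  maximum \<open>l\<close>, then \<open>q w = l * (w \<bullet> w) - w \<bullet> (S *v w)\<close> is a nonnegative form on \<open>W\<close> that vanishes
  at \<open>v\<close>. Moving from \<open>v\<close> along \<open>r = l *\<^sub>R v - S *v v\<close> changes it by a term linear in the step
  plus a quadratic one, so the linear coefficient \<open>r \<bullet> r\<close> must vanish.
\<close>
lemma rayleigh_maximizer_eigenvector: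
  fixes S :: "real^'n^'n"
  assumes S: "transpose S = S" and W: "subspace W" "W \<noteq> {0}" "\<And>w. w \<in> W \<Longrightarrow> S *v w \<in> W"
  obtains v l where "v \<in> W" "norm v = 1" "S *v v = l *\<^sub>R v"
    "\<And>w. w \<in> W \<Longrightarrow> w \<bullet> (S *v w) \<le> l * (w \<bullet> w)"
proof -
  let ?K = "sphere 0 1 \<inter> W"
  have K: "compact ?K"
    by (simp add: W(1) closed_subspace compact_Int_closed)
  obtain w0 where w0: "w0 \<in> W" "w0 \<noteq> 0"
    using W(1,2) subspace_0 by blast
  have "w0 /\<^sub>R norm w0 \<in> ?K"
    using w0 W(1) by (simp add: subspace_scale)
  hence "?K \<noteq> {}" by blast
  moreover have "continuous_on ?K (\<lambda>v. v \<bullet> (S *v v))"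
    by (intro continuous_intros matrix_vector_mult_linear_continuous_on)
  ultimately obtain v where v: "v \<in> ?K" and vmax: "\<And>w. w \<in> ?K \<Longrightarrow> w \<bullet> (S *v w) \<le> v \<bullet> (S *v v)"
    using continuous_attains_sup[OF K, of "\<lambda>v. v \<bullet> (S *v v)"] by blast
  define l where "l = v \<bullet> (S *v v)"
  have nv: "norm v = 1" and vW: "v \<in> W" using v by auto
  have ray: "w \<bullet> (S *v w) \<le> l * (w \<bullet> w)" if "w \<in> W" for w
  proof (cases "w = 0")
    case False
    have "w /\<^sub>R norm w \<in> ?K"
      using that False W(1) by (simp add: subspace_scale)
    from vmax[OF this] have "inverse (norm w) * (inverse (norm w) * (w \<bullet> (S *v w))) \<le> l"
      by (simp add: l_def matrix_vector_mult_scaleR)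
    hence "w \<bullet> (S *v w) \<le> l * (norm w * norm w)"
      using False by (simp add: field_simps)
    thus ?thesis by (simp add: power2_norm_eq_inner[symmetric] power2_eq_square)
  qed auto
  define r where "r = l *\<^sub>R v - S *v v"
  have rW: "r \<in> W" unfolding r_def using W vW by (intro subspace_diff subspace_scale) auto
  define q where "q w = l * (w \<bullet> w) - w \<bullet> (S *v w)" for w
  have vv: "v \<bullet> v = 1" using nv by (simp add: norm_eq_1)
  have expand: "q (v - t *\<^sub>R r) = - 2 * t * (r \<bullet> r) + t\<^sup>2 * q r" for t
  proof -
    have "v \<bullet> (S *v r) = r \<bullet> (S *v v)"
      using S by (metis inner_commute inner_matrix_vector_transpose)
    hence "q (v - t *\<^sub>R r) = q v - 2 * t * (l * (r \<bullet> v) - r \<bullet> (S *v v)) + t\<^sup>2 * q r"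
      unfolding q_def
      by (simp add: matrix_vector_mult_diff_distrib matrix_vector_mult_scaleR inner_diff_left
          inner_diff_right inner_commute[of v r] power2_eq_square algebra_simps)
    moreover have "l * (r \<bullet> v) - r \<bullet> (S *v v) = r \<bullet> r"
      by (subst (4) r_def) (simp add: inner_diff_right)
    moreover have "q v = 0" by (simp add: q_def l_def vv)
    ultimately show ?thesis by simp
  qed
  have nonneg: "0 \<le> - 2 * t * (r \<bullet> r) + t\<^sup>2 * q r" for t
  proof -
    have "v - t *\<^sub>R r \<in> W" using W(1) vW rW by (intro subspace_diff subspace_scale)
    hence "0 \<le> q (v - t *\<^sub>R r)" using ray by (simp add: q_def)
    thus ?thesis by (simp add: expand)
  qed
  have "r \<bullet> r = 0"
  proof (rule ccontr)
    assume "r \<bullet> r \<noteq> 0"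
    hence r: "r \<bullet> r > 0" by (simp add: order_less_le)
    have q: "q r \<ge> 0" using ray[OF rW] by (simp add: q_def)
    \<comment> \<open>A step so short that the quadratic term is at most half of the linear one. Adding 1 to the
      denominator allows for \<open>q r = 0\<close>.\<close>
    define t where "t = (r \<bullet> r) / (q r + 1)"
    have t: "t > 0" "t * (q r + 1) = r \<bullet> r" using r q by (auto simp: t_def field_simps)
    have "t * q r \<le> r \<bullet> r" using t by (simp add: algebra_simps)
    hence "t * (t * q r) \<le> t * (r \<bullet> r)" using t(1) by simp
    moreover have "0 < t * (r \<bullet> r)" using t(1) r by simp
    ultimately show False using nonneg[of t] by (simp add: power2_eq_square algebra_simps)
  qed
  hence "S *v v = l *\<^sub>R v" by (simp add: r_def)
  thus thesis using that vW nv ray by blast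
qed

text \<open>
  An orthonormal set of eigenvectors of maximal size spans the space: its orthogonal complement
  is invariant under \<open>S\<close>, and a further eigenvector in it could be added.
\<close>
lemma symmetric_matrix_eigenbasis:
  fixes S :: "real^'n^'n"
  assumes S: "transpose S = S"
  obtains E l where "finite E" "pairwise orthogonal E" "\<And>e. e \<in> E \<Longrightarrow> norm e = 1"
    "span E = UNIV" "\<And>e. e \<in> E \<Longrightarrow> S *v e = l e *\<^sub>R e"
proof -
  define good where "good E \<longleftrightarrow> pairwise orthogonal E \<and>
    (\<forall>e\<in>E. norm e = 1 \<and> (\<exists>l. S *v e = l *\<^sub>R e))" for E
  have indep: "independent E" if "good E" for E
    using that by (intro pairwise_orthogonal_independent) (auto simp: good_def)
  have bound: "card E < Suc DIM(real^'n)" if "good E" for E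
    using independent_bound[OF indep[OF that]] by simp
  have "good {}" by (simp add: good_def)
  then obtain E where E: "good E" and Emax: "\<And>F. good F \<Longrightarrow> card F \<le> card E"
    using ex_has_greatest_nat[of good "{}" card "Suc DIM(real^'n)"] bound
    by (metis less_imp_le)
  have fin: "finite E" using independent_bound[OF indep[OF E]] by simp
  have span: "span E = UNIV"
  proof (rule ccontr)
    assume "span E \<noteq> UNIV"
    define W where "W = {w. \<forall>e\<in>E. e \<bullet> w = 0}"
    have sub: "subspace W"
      by (auto simp: W_def subspace_def inner_right_distrib)
    obtain w where w: "w \<noteq> 0" "\<And>y. y \<in> span E \<Longrightarrow> orthogonal w y"
      using span_not_univ_subset_hyperplane[of E] \<open>span E \<noteq> UNIV\<close>
      by (auto simp: orthogonal_def)
    have "w \<in> W"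
      using w(2)[OF span_base] by (auto simp: W_def orthogonal_def inner_commute)
    hence "W \<noteq> {0}" using w(1) by blast
    moreover have "S *v x \<in> W" if "x \<in> W" for x
    proof -
      have "e \<bullet> (S *v x) = 0" if e: "e \<in> E" for e
      proof -
        obtain l where "S *v e = l *\<^sub>R e" using E e by (auto simp: good_def)
        thus ?thesis using \<open>x \<in> W\<close> e
          by (simp add: inner_matrix_vector_transpose S W_def)
      qed
      thus ?thesis by (simp add: W_def)
    qed
    ultimately obtain v l where v: "v \<in> W" "norm v = 1" "S *v v = l *\<^sub>R v"
      using rayleigh_maximizer_eigenvector[OF S sub] by metis
    have "v \<notin> E"
      using v by (auto simp: W_def)
    moreover have "good (insert v E)"
      using E v by (auto simp: good_def pairwise_insert orthogonal_def W_def inner_commute)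
    ultimately show False
      using Emax[of "insert v E"] fin by simp
  qed
  obtain l where "\<forall>e\<in>E. S *v e = l e *\<^sub>R e"
    using E unfolding good_def by metis
  thus thesis using that[of E l] E fin span by (auto simp: good_def)
qed

lemma orthonormal_expansion:
  fixes E :: "(real^'n) set"
  assumes E: "finite E" "pairwise orthogonal E" "\<And>e. e \<in> E \<Longrightarrow> norm e = 1" "span E = UNIV"
  shows "(\<Sum>e\<in>E. (e \<bullet> x) *\<^sub>R e) = x"
proof (rule ccontr)
  let ?y = "x - (\<Sum>e\<in>E. (e \<bullet> x) *\<^sub>R e)"
  assume nonzero: "(\<Sum>e\<in>E. (e \<bullet> x) *\<^sub>R e) \<noteq> x"
  have "orthogonal ?y e" if e: "e \<in> E" for e
  proof -
    have "(\<Sum>f\<in>E. (f \<bullet> x) * (f \<bullet> e)) = (\<Sum>f\<in>E. if f = e then e \<bullet> x else 0)"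
    proof (rule sum.cong)
      fix f assume f: "f \<in> E"
      show "f \<bullet> x * (f \<bullet> e) = (if f = e then e \<bullet> x else 0)"
        using E(2) E(3)[OF f] e f by (auto simp: pairwise_def orthogonal_def norm_eq_1)
    qed simp
    thus ?thesis
      using e E(1) by (simp add: orthogonal_def inner_diff_left inner_sum_left inner_commute[of e x])
  qed
  hence "orthogonal ?y y" for y
    using orthogonal_to_span[of y E ?y] E(4) by auto
  hence "?y = 0" by (metis orthogonal_self)
  thus False using nonzero by simp
qed

text \<open>
  This turns \<open>lambda_max\<close>, defined through eigenvalues, into the best constant of a quadratic
  inequality, which is the only form in which it is used.
\<close>
lemma lambda_max_le_iff:
  fixes S :: "real^'n^'n"
  assumes S: "transpose S = S"
  shows "lambda_max S \<le> t \<longleftrightarrow> (\<forall>v. v \<bullet> (S *v v) \<le> t * (v \<bullet> v))"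
proof -
  obtain E ev where E: "finite E" "pairwise orthogonal E" "\<And>e. e \<in> E \<Longrightarrow> norm e = 1"
    "span E = UNIV" "\<And>e. e \<in> E \<Longrightarrow> S *v e = ev e *\<^sub>R e"
    using symmetric_matrix_eigenbasis[OF S] by metis
  have "mat_eigenvalues S \<subseteq> ev ` E"
  proof
    fix c assume "c \<in> mat_eigenvalues S"
    then obtain v where v: "v \<noteq> 0" "S *v v = c *\<^sub>R v" by (auto simp: mat_eigenvalues_def)
    have "\<exists>e\<in>E. e \<bullet> v \<noteq> 0"
      using orthonormal_expansion[OF E(1-4), of v] v(1)
      by (metis (no_types, lifting) scale_eq_0_iff sum.neutral)
    then obtain e where e: "e \<in> E" "e \<bullet> v \<noteq> 0" by blast
    have "c * (e \<bullet> v) = e \<bullet> (S *v v)" by (simp add: v)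
    also have "\<dots> = ev e * (e \<bullet> v)" by (simp add: inner_matrix_vector_transpose S E(5)[OF e(1)])
    finally show "c \<in> ev ` E" using e by auto
  qed
  hence fin: "finite (mat_eigenvalues S)" using E(1) finite_surj by blast
  have "UNIV \<noteq> {0 :: real^'n}"
    by (metis UNIV_I axis_eq_0_iff one_neq_zero singletonD)
  then obtain v l where v: "norm v = 1" "S *v v = l *\<^sub>R v"
    "\<And>w. w \<bullet> (S *v w) \<le> l * (w \<bullet> w)"
    using rayleigh_maximizer_eigenvector[OF S subspace_UNIV] by (metis UNIV_I)
  have lin: "l \<in> mat_eigenvalues S"
    using v(1,2) by (auto simp: mat_eigenvalues_def intro!: exI[of _ v])
  have "c \<le> l" if c: "c \<in> mat_eigenvalues S" for c
  proof -
    obtain w where w: "w \<noteq> 0" "S *v w = c *\<^sub>R w" using c by (auto simp: mat_eigenvalues_def)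
    have "0 < w \<bullet> w" "c * (w \<bullet> w) \<le> l * (w \<bullet> w)" using v(3)[of w] w by auto
    thus ?thesis by simp
  qed
  hence l: "lambda_max S = l"
    unfolding lambda_max_def using fin lin by (intro Max_eqI) auto
  show ?thesis unfolding l
  proof
    assume "l \<le> t"
    thus "\<forall>v. v \<bullet> (S *v v) \<le> t * (v \<bullet> v)"
      using v(3) by (meson inner_ge_zero mult_right_mono order_trans)
  next
    assume "\<forall>v. v \<bullet> (S *v v) \<le> t * (v \<bullet> v)"
    from spec[OF this, of v] show "l \<le> t" using v(1,2) by (simp add: norm_eq_1)
  qed
qed

text \<open>
  The root multiplies each vector of an eigenbasis by the square root of its eigenvalue.
\<close>
lemma pos_semidef_has_sqrt:
  fixes S :: "real^'n^'n"
  assumes "pos_semidef S"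
  shows "\<exists>R. pos_semidef R \<and> R ** R = S"
proof -
  have S: "transpose S = S" and nonneg: "\<And>v. 0 \<le> v \<bullet> (S *v v)"
    using assms by (auto simp: pos_semidef_def)
  obtain E ev where E: "finite E" "pairwise orthogonal E" "\<And>e. e \<in> E \<Longrightarrow> norm e = 1"
    "span E = UNIV" and ev: "\<And>e. e \<in> E \<Longrightarrow> S *v e = ev e *\<^sub>R e"
    using symmetric_matrix_eigenbasis[OF S] by metis
  have ev0: "ev e \<ge> 0" if "e \<in> E" for e
    using nonneg[of e] ev[OF that] E(3)[OF that] by (simp add: norm_eq_1)
  define f where "f x = (\<Sum>e\<in>E. (sqrt (ev e) * (e \<bullet> x)) *\<^sub>R e)" for x
  have lf: "linear f"
    by (rule linearI) (simp_all add: f_def inner_right_distrib algebra_simps sum.distrib scaleR_sum_right)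
  define R where "R = matrix f"
  have Rf: "R *v x = f x" for x by (simp add: R_def matrix_works lf)
  have fe: "f e = sqrt (ev e) *\<^sub>R e" if e: "e \<in> E" for e
  proof -
    have "f e = (\<Sum>g\<in>E. if g = e then sqrt (ev e) *\<^sub>R e else 0)"
      unfolding f_def
    proof (rule sum.cong)
      fix g assume g: "g \<in> E"
      show "(sqrt (ev g) * (g \<bullet> e)) *\<^sub>R g = (if g = e then sqrt (ev e) *\<^sub>R e else 0)"
        using E(2) E(3)[OF g] e g by (auto simp: pairwise_def orthogonal_def norm_eq_1)
    qed simp
    thus ?thesis using e E(1) by simp
  qed
  have "x \<bullet> f y = f x \<bullet> y" for x y
    by (simp add: f_def inner_sum_left inner_sum_right mult_ac inner_commute)
  hence "adjoint f = f" by (intro adjoint_unique) (metis inner_commute)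
  hence "transpose R = R"
    by (simp add: R_def matrix_adjoint[symmetric] lf)
  moreover have "0 \<le> v \<bullet> (R *v v)" for v
    unfolding Rf f_def inner_sum_right 
    by (intro sum_nonneg) (simp add: ev0 inner_commute mult.assoc)
  moreover have "R ** R = S"
  proof -
    have "(R ** R) *v e = S *v e" if "e \<in> E" for e
      using ev0[OF that] by (simp add: matrix_vector_mul_assoc[symmetric] Rf fe[OF that] ev[OF that]
          linear_scale[OF lf])
    hence "(R ** R) *v x = S *v x" for x
      using linear_eq_on_span[of "(*v) (R ** R)" "(*v) S" E x] E(4) by auto
    thus ?thesis by (simp add: matrix_eq)
  qed
  ultimately show ?thesis by (auto simp: pos_semidef_def)
qed

section \<open>The positive semidefinite square root\<close>

lemma norm_matrix_vector_mult_le: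
  fixes A :: "real^'n^'m"
  shows "norm (A *v x) \<le> norm A * norm x"
proof -
  have "norm (A *v x) = L2_set (\<lambda>i. \<bar>A $ i \<bullet> x\<bar>) UNIV"
    by (simp add: norm_vec_def matrix_mult_dot)
  also have "\<dots> \<le> L2_set (\<lambda>i. norm (A $ i) * norm x) UNIV"
    by (intro L2_set_mono Cauchy_Schwarz_ineq2) auto
  also have "\<dots> = norm A * norm x"
    by (simp add: norm_vec_def L2_set_left_distrib)
  finally show ?thesis .
qed

lemma norm_matrix_le_entries:
  fixes A :: "real^'n^'m"
  assumes "\<And>i j. \<bar>A $ i $ j\<bar> \<le> s"
  shows "norm A \<le> real CARD('m) * real CARD('n) * s"
proof -
  have "norm A \<le> (\<Sum>i\<in>UNIV. norm (A $ i))"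
    unfolding norm_vec_def by (rule L2_set_le_sum) simp
  also have "\<dots> \<le> (\<Sum>i\<in>(UNIV::'m set). real CARD('n) * s)"
  proof (rule sum_mono)
    fix i
    have "norm (A $ i) \<le> (\<Sum>j\<in>UNIV. \<bar>A $ i $ j\<bar>)" by (rule norm_le_l1_cart)
    also have "\<dots> \<le> (\<Sum>j\<in>(UNIV::'n set). s)" by (rule sum_mono) (rule assms)
    finally show "norm (A $ i) \<le> real CARD('n) * s" by simp
  qed
  finally show ?thesis by simp
qed

lemma matrix_entry_inner: "A $ i $ j = axis i 1 \<bullet> (A *v axis j (1::real))"
  by (simp add: matrix_vector_mul_component inner_axis inner_commute[of "axis i 1"])

text \<open>
  Polarization: a symmetric bilinear form is controlled by its values on the diagonal.
\<close>
lemma symmetric_entry_le_numerical_radius: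
  fixes D :: "real^'n^'n"
  assumes D: "transpose D = D" and s: "\<And>v. \<bar>v \<bullet> (D *v v)\<bar> \<le> s * (v \<bullet> v)"
  shows "\<bar>D $ i $ j\<bar> \<le> s"
proof -
  let ?x = "axis i 1 :: real^'n" and ?y = "axis j 1 :: real^'n"
  have sym: "?y \<bullet> (D *v ?x) = ?x \<bullet> (D *v ?y)"
    using D by (metis inner_commute inner_matrix_vector_transpose)
  have "(?x + ?y) \<bullet> (D *v (?x + ?y)) - (?x - ?y) \<bullet> (D *v (?x - ?y)) = 4 * (?x \<bullet> (D *v ?y))"
    by (simp add: matrix_vector_right_distrib matrix_vector_mult_diff_distrib
        inner_left_distrib inner_right_distrib inner_diff_left inner_diff_right sym)
  hence "4 * \<bar>?x \<bullet> (D *v ?y)\<bar>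
      \<le> \<bar>(?x + ?y) \<bullet> (D *v (?x + ?y))\<bar> + \<bar>(?x - ?y) \<bullet> (D *v (?x - ?y))\<bar>"
    by linarith
  also have "\<dots> \<le> s * ((?x + ?y) \<bullet> (?x + ?y)) + s * ((?x - ?y) \<bullet> (?x - ?y))"
    by (intro add_mono s)
  also have "\<dots> = s * (2 * (?x \<bullet> ?x) + 2 * (?y \<bullet> ?y))"
    by (simp add: inner_left_distrib inner_right_distrib inner_diff_left inner_diff_right algebra_simps)
  also have "\<dots> = 4 * s" by (simp add: inner_axis_axis)
  finally show ?thesis by (simp add: matrix_entry_inner)
qed

text \<open>
  The square root is \<open>1/2\<close>-Hoelder continuous. Let \<open>l > 0\<close> be the largest eigenvalue of
  \<open>R - R'\<close> and \<open>w\<close> a unit eigenvector. Then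
  \<open>w \<bullet> (R\<^sup>2 - R'\<^sup>2) w = ((R - R') w) \<bullet> ((R + R') w) = l * (w \<bullet> (R + R') w)\<close>, and this is at least
  \<open>l * (w \<bullet> (R - R') w) = l\<^sup>2\<close> because \<open>R'\<close> is positive semidefinite. With \<open>t = 0\<close> the estimate
  gives uniqueness of the root, with \<open>t\<close> the distance of the squares its continuity.
\<close>
lemma psd_root_difference:
  fixes R R' :: "real^'n^'n"
  assumes R: "pos_semidef R" "pos_semidef R'"
    and t: "\<And>v. \<bar>v \<bullet> ((R ** R - R' ** R') *v v)\<bar> \<le> t * (v \<bullet> v)"
  shows "v \<bullet> ((R - R') *v v) \<le> sqrt t * (v \<bullet> v)"
proof -
  have sym: "transpose R = R" "transpose R' = R'" using R by (auto simp: pos_semidef_def)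
  have symD: "transpose (R - R') = R - R'"
    using sym by (simp add: transpose_def vec_eq_iff)
  have "UNIV \<noteq> {0 :: real^'n}"
    by (metis UNIV_I axis_eq_0_iff one_neq_zero singletonD)
  then obtain w l where w: "norm w = 1" "(R - R') *v w = l *\<^sub>R w"
    and ray: "\<And>v. v \<bullet> ((R - R') *v v) \<le> l * (v \<bullet> v)"
    using rayleigh_maximizer_eigenvector[OF symD subspace_UNIV] by (metis UNIV_I)
  have "l \<le> sqrt t"
  proof (cases "l \<le> 0")
    case True
    have "0 \<le> t" using t[of w] w(1) by (simp add: norm_eq_1)
    thus ?thesis using True by (meson order_trans real_sqrt_ge_zero)
  next
    case False
    have ww: "w \<bullet> w = 1" using w(1) by (simp add: norm_eq_1)
    let ?a = "R *v w" and ?b = "R' *v w"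
    have ab: "?a - ?b = l *\<^sub>R w"
      using w(2) by (simp add: matrix_vector_mult_diff_rdistrib)
    have "w \<bullet> ?a - w \<bullet> ?b = l"
      using arg_cong[OF ab, of "\<lambda>x. w \<bullet> x"] by (simp add: inner_diff_right ww)
    moreover have "0 \<le> w \<bullet> ?b" using R(2) by (simp add: pos_semidef_def)
    ultimately have "l \<le> w \<bullet> (?a + ?b)" by (simp add: inner_right_distrib)
    hence "l * l \<le> l * (w \<bullet> (?a + ?b))" using False by simp
    also have "\<dots> = (?a - ?b) \<bullet> (?a + ?b)" by (simp add: ab)
    also have "\<dots> = ?a \<bullet> ?a - ?b \<bullet> ?b"
      by (simp add: inner_diff_left inner_right_distrib inner_commute[of ?b ?a])
    also have "\<dots> = w \<bullet> ((R ** R - R' ** R') *v w)"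
      by (simp add: matrix_vector_mult_diff_rdistrib inner_diff_right
          matrix_vector_mul_assoc[symmetric] inner_matrix_vector_transpose[of w] sym)
    also have "\<dots> \<le> t" using t[of w] by (simp add: ww)
    finally show ?thesis by (intro real_le_rsqrt) (simp add: power2_eq_square)
  qed
  thus ?thesis using ray[of v] by (meson inner_ge_zero mult_right_mono order_trans)
qed

lemma psd_root_entry_difference:
  fixes R R' :: "real^'n^'n"
  assumes R: "pos_semidef R" "pos_semidef R'"
    and t: "\<And>v. \<bar>v \<bullet> ((R ** R - R' ** R') *v v)\<bar> \<le> t * (v \<bullet> v)"
  shows "\<bar>(R - R') $ i $ j\<bar> \<le> sqrt t"
proof (rule symmetric_entry_le_numerical_radius)
  show "transpose (R - R') = R - R'"
    using R by (simp add: transpose_def vec_eq_iff pos_semidef_def)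
  fix v
  have "\<bar>v \<bullet> ((R' ** R' - R ** R) *v v)\<bar> \<le> t * (v \<bullet> v)" for v
    using t[of v] by (simp add: matrix_vector_mult_diff_rdistrib inner_diff_right abs_minus_commute)
  from psd_root_difference[OF R t, of v] psd_root_difference[OF R(2,1) this, of v]
  show "\<bar>v \<bullet> ((R - R') *v v)\<bar> \<le> sqrt t * (v \<bullet> v)"
    by (simp add: matrix_vector_mult_diff_rdistrib inner_diff_right abs_le_iff)
qed

lemma psd_sqrt:
  assumes "pos_semidef S"
  shows "pos_semidef (psd_sqrt S)" "psd_sqrt S ** psd_sqrt S = S"
proof -
  have "R = R'" if "pos_semidef R" "pos_semidef R'" "R ** R = R' ** R'" for R R' :: "real^'n^'n"
    using psd_root_entry_difference[OF that(1,2), of 0] that(3) by (simp add: vec_eq_iff)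
  hence "\<exists>!R. pos_semidef R \<and> R ** R = S"
    using pos_semidef_has_sqrt[OF assms] by (metis (no_types, lifting))
  from theI'[OF this] show "pos_semidef (psd_sqrt S)" "psd_sqrt S ** psd_sqrt S = S"
    by (simp_all add: psd_sqrt_def)
qed

lemma continuous_on_psd_sqrt: "continuous_on {S :: real^'n^'n. pos_semidef S} psd_sqrt"
proof (unfold continuous_on_iff, intro ballI allI impI)
  fix S :: "real^'n^'n" and e :: real
  assume S: "S \<in> {S. pos_semidef S}" and e: "e > 0"
  let ?C = "real CARD('n) * real CARD('n)"
  have C: "?C > 0" by simp
  have "dist (psd_sqrt T) (psd_sqrt S) < e" if T: "pos_semidef T" "dist T S < (e / ?C)\<^sup>2" for T
  proof -
    have "\<bar>v \<bullet> ((T - S) *v v)\<bar> \<le> dist T S * (v \<bullet> v)" for v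
    proof -
      have "\<bar>v \<bullet> ((T - S) *v v)\<bar> \<le> norm v * norm ((T - S) *v v)"
        by (rule Cauchy_Schwarz_ineq2)
      also have "\<dots> \<le> norm v * (norm (T - S) * norm v)"
        by (intro mult_left_mono norm_matrix_vector_mult_le) simp
      also have "\<dots> = dist T S * (v \<bullet> v)"
        by (simp add: dist_norm power2_norm_eq_inner[symmetric] power2_eq_square)
      finally show ?thesis .
    qed
    hence "\<bar>(psd_sqrt T - psd_sqrt S) $ i $ j\<bar> \<le> sqrt (dist T S)" for i j
      using S T(1) by (intro psd_root_entry_difference) (simp_all add: psd_sqrt)
    from norm_matrix_le_entries[OF this]
    have "dist (psd_sqrt T) (psd_sqrt S) \<le> ?C * sqrt (dist T S)"
      by (simp add: dist_norm)
    also have "\<dots> < ?C * (e / ?C)"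
      using T(2) C e by (intro mult_strict_left_mono real_less_lsqrt) auto
    finally show ?thesis using C by simp
  qed
  thus "\<exists>d>0. \<forall>T\<in>{S. pos_semidef S}. dist T S < d \<longrightarrow> dist (psd_sqrt T) (psd_sqrt S) < e"
    using e C by (intro exI[of _ "(e / ?C)\<^sup>2"]) auto
qed

lemma pos_semidef_gram: "pos_semidef (A ** transpose (A :: real^'n^'m))"
proof -
  have "v \<bullet> ((A ** transpose A) *v v) = (transpose A *v v) \<bullet> (transpose A *v v)" for v
    by (simp add: matrix_vector_mul_assoc[symmetric] inner_matrix_vector_transpose)
  thus ?thesis by (simp add: pos_semidef_def matrix_transpose_mul)
qed

lemma closed_pos_semidef: "closed {S :: real^'n^'n. pos_semidef S}"
proof -
  have "{S :: real^'n^'n. pos_semidef S} =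
    {S. \<forall>i j. S $ i $ j = S $ j $ i} \<inter> {S. \<forall>v. 0 \<le> v \<bullet> (\<chi> i. S $ i \<bullet> v)}"
    by (auto simp: pos_semidef_def transpose_def vec_eq_iff matrix_mult_dot)
  also have "closed \<dots>"
    by (intro closed_Int closed_Collect_all closed_Collect_eq closed_Collect_le continuous_intros)
  finally show ?thesis .
qed

section \<open>Families of vectors with equal Gram matrices\<close>

text \<open>
  Two families with the same inner products differ by a rotation or reflection. The vectors are
  matched one at a time: once \<open>f\<close> matches those in \<open>I\<close>, the difference \<open>w = f (q j) - p j\<close> is
  orthogonal to every \<open>p i\<close> with \<open>i \<in> I\<close>, so the reflection in the hyperplane orthogonal to \<open>w\<close>
  leaves these fixed, and it sends \<open>f (q j)\<close> to \<open>p j\<close> because both have the same length.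
\<close>
lemma equal_gram_orthogonal_transformation:
  fixes p q :: "'i \<Rightarrow> 'a::euclidean_space"
  assumes "finite I" "\<And>i j. i \<in> I \<Longrightarrow> j \<in> I \<Longrightarrow> p i \<bullet> p j = q i \<bullet> q j"
  shows "\<exists>f. orthogonal_transformation f \<and> (\<forall>i\<in>I. f (q i) = p i)"
  using assms
proof (induction I rule: finite_induct)
  case empty
  show ?case by (intro exI[of _ "\<lambda>x. x"]) (simp add: orthogonal_transformation_id)
next
  case (insert j I)
  then obtain f where f: "orthogonal_transformation f" "\<And>i. i \<in> I \<Longrightarrow> f (q i) = p i"
    by (metis insertCI)
  have fi: "f x \<bullet> f y = x \<bullet> y" for x y
    using f(1) by (simp add: orthogonal_transformation_def)
  define w where "w = f (q j) - p j"
  define h where "h x = x - (2 * (x \<bullet> w) / (w \<bullet> w)) *\<^sub>R w" for x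
  have "linear h"
    by (rule linearI) (simp_all add: h_def inner_left_distrib add_divide_distrib algebra_simps)
  moreover have "h x \<bullet> h y = x \<bullet> y" for x y
    by (cases "w = 0") (simp_all add: h_def inner_diff_left inner_diff_right inner_commute)
  ultimately have h: "orthogonal_transformation h"
    by (simp add: orthogonal_transformation_def)
  have hI: "h (p i) = p i" if i: "i \<in> I" for i
  proof -
    have "p i \<bullet> w = f (q i) \<bullet> f (q j) - p i \<bullet> p j"
      using i by (simp add: w_def inner_diff_right f)
    also have "\<dots> = 0" using i insert.prems[of i j] by (simp add: fi)
    finally show ?thesis by (simp add: h_def)
  qed
  have hj: "h (f (q j)) = p j"
  proof (cases "w = 0")
    case True
    thus ?thesis by (simp add: h_def w_def)
  next
    case False
    have "f (q j) \<bullet> f (q j) = p j \<bullet> p j" using insert.prems[of j j] by (simp add: fi)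
    hence "2 * (f (q j) \<bullet> w) = w \<bullet> w"
      by (simp add: w_def inner_diff_left inner_diff_right inner_commute)
    thus ?thesis using False by (simp add: h_def) (simp add: w_def)
  qed
  show ?case
    using orthogonal_transformation_compose[OF h f(1)] hI hj f(2)
    by (intro exI[of _ "h \<circ> f"]) (auto simp: o_def)
qed

text \<open>
  The polar decomposition in the form used here: the rows of \<open>P\<close> and \<open>Q\<close> are two families with
  the same Gram matrix.
\<close>
lemma equal_gram_matrices:
  fixes P Q :: "real^'n^'k"
  assumes "P ** transpose P = Q ** transpose Q"
  obtains U where "orthogonal_matrix U" "P = Q ** U"
proof -
  have gram: "(A ** transpose A) $ i $ j = A $ i \<bullet> A $ j" for A :: "real^'n^'k" and i j
    by (simp add: matrix_matrix_mult_def transpose_def inner_vec_def)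
  have "P $ i \<bullet> P $ j = Q $ i \<bullet> Q $ j" for i j
    using assms by (metis gram)
  then obtain f where f: "orthogonal_transformation f" "\<And>i. f (Q $ i) = P $ i"
    using equal_gram_orthogonal_transformation[of UNIV "\<lambda>i. P $ i" "\<lambda>i. Q $ i"] by auto
  define V where "V = matrix f"
  have V: "orthogonal_matrix V" "V *v x = f x" for x
    using f(1) by (auto simp: V_def orthogonal_transformation_matrix matrix_works)
  have "P $ i $ j = (Q ** transpose V) $ i $ j" for i j
    by (simp add: f(2)[symmetric] V(2)[symmetric] matrix_vector_mult_def matrix_matrix_mult_def
        transpose_def mult.commute)
  hence "P = Q ** transpose V" by (simp add: vec_eq_iff)
  moreover have "orthogonal_matrix (transpose V)"
    using V(1) by (simp add: orthogonal_matrix_transpose)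
  ultimately show thesis using that by blast
qed

section \<open>Congruence and measurability\<close>

definition congr :: "real^'n^'k \<Rightarrow> 'n sqmat \<Rightarrow> 'k sqmat" where
  "congr P x = P ** x ** transpose P"

lemma congr_mult: "congr (P ** Q) x = congr P (congr Q x)"
  by (simp add: congr_def matrix_transpose_mul matrix_mul_assoc)

lemma congr_add: "congr P (x + y) = congr P x + congr P y"
  by (simp add: congr_def matrix_matrix_mult_def vec_eq_iff sum.distrib distrib_left distrib_right)

lemma congr_0 [simp]: "congr P 0 = 0"
  by (simp add: congr_def)

lemma congr_mat_1 [simp]: "congr (mat 1) x = x"
  by (simp add: congr_def)

lemma continuous_on_matrix_mult [continuous_intros]:
  fixes f :: "'a::topological_space \<Rightarrow> real^'n^'m" and g :: "'a \<Rightarrow> real^'k^'n"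
  assumes "continuous_on S f" "continuous_on S g"
  shows "continuous_on S (\<lambda>x. f x ** g x)"
  unfolding matrix_matrix_mult_def by (intro continuous_intros assms)

lemma continuous_on_transpose [continuous_intros]:
  fixes f :: "'a::topological_space \<Rightarrow> real^'n^'m"
  assumes "continuous_on S f"
  shows "continuous_on S (\<lambda>x. transpose (f x))"
  unfolding transpose_def by (intro continuous_intros assms)

lemma borel_measurable_matrix_mult [measurable (raw)]:
  fixes f :: "'a \<Rightarrow> real^'n^'m" and g :: "'a \<Rightarrow> real^'k^'n"
  assumes "f \<in> borel_measurable M" "g \<in> borel_measurable M"
  shows "(\<lambda>x. f x ** g x) \<in> borel_measurable M"
  by (intro borel_measurable_continuous_Pair[OF assms] continuous_intros)

lemma borel_measurable_transpose [measurable (raw)]: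
  fixes f :: "'a \<Rightarrow> real^'n^'m"
  assumes "f \<in> borel_measurable M"
  shows "(\<lambda>x. transpose (f x)) \<in> borel_measurable M"
  by (rule borel_measurable_continuous_on[OF _ assms]) (intro continuous_intros)

lemma borel_measurable_congr [measurable (raw)]:
  assumes [measurable]: "f \<in> borel_measurable M" "g \<in> borel_measurable M"
  shows "(\<lambda>x. congr (f x) (g x)) \<in> borel_measurable M"
  unfolding congr_def by measurable

text \<open>
  The square root extended by \<open>0\<close> to a measurable function on all matrices; \<open>psd_sqrt\<close> is
  unspecified outside the positive semidefinite cone.
\<close>
definition psd_root :: "'n::finite sqmat \<Rightarrow> 'n sqmat" where
  "psd_root S = (if pos_semidef S then psd_sqrt S else 0)"

lemma borel_measurable_psd_root [measurable]: "psd_root \<in> borel_measurable borel"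
proof -
  have "(\<lambda>S :: 'a sqmat. if S \<in> {S. pos_semidef S} then psd_sqrt S else 0) \<in> borel_measurable borel"
    by (intro borel_measurable_continuous_on_if continuous_on_psd_sqrt continuous_on_const
        borel_closed closed_pos_semidef)
  thus ?thesis by (simp add: psd_root_def[abs_def])
qed

lemma psd_root_gram:
  assumes "pos_semidef S"
  shows "psd_root S ** transpose (psd_root S) = S"
  using psd_sqrt[OF assms] assms by (simp add: psd_root_def pos_semidef_def)

abbreviation borel_prob :: "'a::topological_space measure \<Rightarrow> bool" where
  "borel_prob \<mu> \<equiv> prob_space \<mu> \<and> sets \<mu> = sets borel"

text \<open>
  The form in which laws are compared below: for nonnegative functions the iterated integrals that
  arise from independence need no integrability.
\<close>
lemma borel_prob_eqI:
  assumes "sets \<mu> = sets borel" "sets \<nu> = sets borel"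
    and "\<And>f :: 'a::topological_space \<Rightarrow> ennreal. f \<in> borel_measurable borel \<Longrightarrow>
      (\<integral>\<^sup>+x. f x \<partial>\<mu>) = (\<integral>\<^sup>+x. f x \<partial>\<nu>)"
  shows "\<mu> = \<nu>"
proof (rule measure_eqI)
  fix S assume S: "S \<in> sets \<mu>"
  thus "emeasure \<mu> S = emeasure \<nu> S"
    using assms(3)[of "indicator S"] assms(1,2) by simp
qed (simp add: assms)

lemma borel_prob_distr:
  assumes "prob_space M" "f \<in> borel_measurable M"
  shows "borel_prob (distr M borel f)"
  using assms by (simp add: prob_space.prob_space_distr)

section \<open>The action of random affine maps on laws\<close>

text \<open>
  A pair \<open>(c, x)\<close> stands for the affine map \<open>z \<mapsto> c z c\<^sup>T + x\<close>. Under composition these maps form a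
  monoid, and a law \<open>p\<close> of \<open>(A, B)\<close> acts on laws of matrices: a solution of
  \<open>X \<sim> A X A\<^sup>T + B\<close> is a law fixed by \<open>p\<close>. Composing \<open>n\<close> independent copies gives the convolution
  power \<open>affine_power p n\<close>, whose first marginal is the law of a product of \<open>n\<close> copies of \<open>A\<close>.
\<close>
type_synonym 'n affine = "'n sqmat \<times> 'n sqmat"

definition affine_map :: "'n::finite affine \<Rightarrow> 'n sqmat \<Rightarrow> 'n sqmat" where
  "affine_map g z = congr (fst g) z + snd g"

definition affine_comp :: "'n::finite affine \<Rightarrow> 'n affine \<Rightarrow> 'n affine" where
  "affine_comp g h = (fst g ** fst h, affine_map g (snd h))"

lemma affine_map_comp: "affine_map (affine_comp g h) z = affine_map g (affine_map h z)"
  by (simp add: affine_comp_def affine_map_def congr_add congr_mult add.assoc)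

lemma affine_comp_assoc:
  "affine_comp (affine_comp g h) k = affine_comp g (affine_comp h k)"
  by (simp add: affine_comp_def affine_map_def congr_add congr_mult add.assoc matrix_mul_assoc)

lemma affine_comp_one [simp]: "affine_comp (mat 1, 0) g = g" "affine_comp g (mat 1, 0) = g"
  by (simp_all add: affine_comp_def affine_map_def)

lemma borel_measurable_affine_map [measurable (raw)]:
  assumes [measurable]: "f \<in> borel_measurable M" "g \<in> borel_measurable M"
  shows "(\<lambda>x. affine_map (f x) (g x)) \<in> borel_measurable M"
proof -
  have [measurable]: "(\<lambda>x. fst (f x)) \<in> borel_measurable M" "(\<lambda>x. snd (f x)) \<in> borel_measurable M"
    using assms(1) by (simp_all add: borel_prod[symmetric])
  show ?thesis unfolding affine_map_def by measurable
qed

lemma borel_measurable_affine_comp [measurable (raw)]: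
  assumes [measurable]: "f \<in> borel_measurable M" "g \<in> borel_measurable M"
  shows "(\<lambda>x. affine_comp (f x) (g x)) \<in> borel_measurable M"
proof -
  have [measurable]: "(\<lambda>x. fst (f x)) \<in> borel_measurable M" "(\<lambda>x. fst (g x)) \<in> borel_measurable M"
    "(\<lambda>x. snd (g x)) \<in> borel_measurable M"
    using assms by (simp_all add: borel_prod[symmetric])
  show ?thesis unfolding affine_comp_def by measurable
qed

definition affine_push :: "'n::finite affine measure \<Rightarrow> 'n sqmat measure \<Rightarrow> 'n sqmat measure" where
  "affine_push p \<nu> = distr (p \<Otimes>\<^sub>M \<nu>) borel (\<lambda>(g, z). affine_map g z)"

definition affine_conv :: "'n::finite affine measure \<Rightarrow> 'n affine measure \<Rightarrow> 'n affine measure" where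
  "affine_conv p q = distr (p \<Otimes>\<^sub>M q) borel (\<lambda>(g, h). affine_comp g h)"

lemma measurable_pair_borel:
  assumes "sets p = sets borel" "sets \<nu> = sets borel"
    "(\<lambda>x. f (fst x) (snd x)) \<in> borel_measurable (borel \<Otimes>\<^sub>M borel)"
  shows "(\<lambda>(g, z). f g z) \<in> borel_measurable (p \<Otimes>\<^sub>M \<nu>)"
  using assms by (simp add: measurable_cong_sets[OF sets_pair_measure_cong[OF assms(1,2)] refl] split_beta')

lemma borel_prob_affine_push:
  assumes "borel_prob p" "borel_prob \<nu>"
  shows "borel_prob (affine_push p \<nu>)"
proof -
  interpret p: prob_space p using assms by simp
  interpret \<nu>: prob_space \<nu> using assms by simp
  interpret pair_prob_space p \<nu> ..
  show ?thesis unfolding affine_push_def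
    using assms by (intro borel_prob_distr[OF prob_space_axioms] measurable_pair_borel) auto
qed

lemma borel_prob_affine_conv:
  assumes "borel_prob p" "borel_prob q"
  shows "borel_prob (affine_conv p q)"
proof -
  interpret p: prob_space p using assms by simp
  interpret q: prob_space q using assms by simp
  interpret pair_prob_space p q ..
  show ?thesis unfolding affine_conv_def
    using assms by (intro borel_prob_distr[OF prob_space_axioms] measurable_pair_borel) auto
qed

lemma nn_integral_affine_push:
  assumes "borel_prob p" "borel_prob \<nu>" and f: "f \<in> borel_measurable borel"
  shows "(\<integral>\<^sup>+x. f x \<partial>affine_push p \<nu>) = (\<integral>\<^sup>+g. \<integral>\<^sup>+z. f (affine_map g z) \<partial>\<nu> \<partial>p)"
proof -
  interpret \<nu>: prob_space \<nu> using assms by simp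
  have m: "(\<lambda>(g, z). affine_map g z) \<in> borel_measurable (p \<Otimes>\<^sub>M \<nu>)"
    using assms by (intro measurable_pair_borel) auto
  have "(\<integral>\<^sup>+x. f x \<partial>affine_push p \<nu>) = (\<integral>\<^sup>+x. f (affine_map (fst x) (snd x)) \<partial>(p \<Otimes>\<^sub>M \<nu>))"
    unfolding affine_push_def using m f by (subst nn_integral_distr) (auto simp: split_beta')
  also have "\<dots> = (\<integral>\<^sup>+g. \<integral>\<^sup>+z. f (affine_map g z) \<partial>\<nu> \<partial>p)"
    using measurable_compose[OF m f]
    by (subst \<nu>.nn_integral_fst[symmetric]) (auto simp: split_beta')
  finally show ?thesis .
qed

lemma nn_integral_affine_conv:
  assumes "borel_prob p" "borel_prob q" and f: "f \<in> borel_measurable borel"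
  shows "(\<integral>\<^sup>+x. f x \<partial>affine_conv p q) = (\<integral>\<^sup>+g. \<integral>\<^sup>+h. f (affine_comp g h) \<partial>q \<partial>p)"
proof -
  interpret q: prob_space q using assms by simp
  have m: "(\<lambda>(g, z). affine_comp g z) \<in> borel_measurable (p \<Otimes>\<^sub>M q)"
    using assms by (intro measurable_pair_borel) auto
  have "(\<integral>\<^sup>+x. f x \<partial>affine_conv p q) = (\<integral>\<^sup>+x. f (affine_comp (fst x) (snd x)) \<partial>(p \<Otimes>\<^sub>M q))"
    unfolding affine_conv_def using m f by (subst nn_integral_distr) (auto simp: split_beta')
  also have "\<dots> = (\<integral>\<^sup>+g. \<integral>\<^sup>+h. f (affine_comp g h) \<partial>q \<partial>p)"
    using measurable_compose[OF m f]
    by (subst q.nn_integral_fst[symmetric]) (auto simp: split_beta')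
  finally show ?thesis .
qed

lemma borel_measurable_nn_integral_borel:
  fixes f :: "'a::second_countable_topology \<Rightarrow> 'b::second_countable_topology \<Rightarrow> ennreal"
  assumes "borel_prob \<nu>" "(\<lambda>x. f (fst x) (snd x)) \<in> borel_measurable (borel \<Otimes>\<^sub>M borel)"
  shows "(\<lambda>g. \<integral>\<^sup>+z. f g z \<partial>\<nu>) \<in> borel_measurable borel"
proof -
  interpret prob_space \<nu> using assms by simp
  show ?thesis
    using assms by (intro borel_measurable_nn_integral measurable_pair_borel) auto
qed

text \<open>
  Composition of maps corresponds to convolution of their laws; hence the iterates of the action
  of \<open>p\<close> are the actions of its convolution powers.
\<close>
lemma affine_push_conv:
  assumes p: "borel_prob p" and q: "borel_prob q" and \<nu>: "borel_prob \<nu>"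
  shows "affine_push (affine_conv p q) \<nu> = affine_push p (affine_push q \<nu>)"
proof (rule borel_prob_eqI)
  fix f :: "'a sqmat \<Rightarrow> ennreal" assume f [measurable]: "f \<in> borel_measurable borel"
  have [measurable]: "(\<lambda>g. \<integral>\<^sup>+z. f (affine_map g z) \<partial>\<nu>) \<in> borel_measurable borel"
    by (rule borel_measurable_nn_integral_borel[OF \<nu>]) measurable
  show "(\<integral>\<^sup>+x. f x \<partial>affine_push (affine_conv p q) \<nu>) = (\<integral>\<^sup>+x. f x \<partial>affine_push p (affine_push q \<nu>))"
    using p q \<nu>
    by (simp add: nn_integral_affine_push nn_integral_affine_conv borel_prob_affine_push
        borel_prob_affine_conv affine_map_comp)
qed (simp_all add: affine_push_def)

lemma affine_conv_assoc:
  assumes p: "borel_prob p" and q: "borel_prob q" and r: "borel_prob r"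
  shows "affine_conv (affine_conv p q) r = affine_conv p (affine_conv q r)"
proof (rule borel_prob_eqI)
  fix f :: "'a affine \<Rightarrow> ennreal" assume f [measurable]: "f \<in> borel_measurable borel"
  have [measurable]: "(\<lambda>g. \<integral>\<^sup>+h. f (affine_comp g h) \<partial>r) \<in> borel_measurable borel"
    by (rule borel_measurable_nn_integral_borel[OF r]) measurable
  show "(\<integral>\<^sup>+x. f x \<partial>affine_conv (affine_conv p q) r) = (\<integral>\<^sup>+x. f x \<partial>affine_conv p (affine_conv q r))"
    using p q r
    by (simp add: nn_integral_affine_conv borel_prob_affine_conv affine_comp_assoc)
qed (simp_all add: affine_conv_def)

primrec affine_power :: "'n::finite affine measure \<Rightarrow> nat \<Rightarrow> 'n affine measure" where
  "affine_power p 0 = return borel (mat 1, 0)"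
| "affine_power p (Suc n) = affine_conv p (affine_power p n)"

lemma borel_prob_affine_power: "borel_prob p \<Longrightarrow> borel_prob (affine_power p n)"
  by (induction n) (auto simp: borel_prob_affine_conv intro!: prob_space_return)

lemma affine_conv_one:
  assumes p: "borel_prob p"
  shows "affine_conv (return borel (mat 1, 0)) p = p" (is ?L)
    and "affine_conv p (return borel (mat 1, 0)) = p" (is ?R)
proof -
  have one: "borel_prob (return borel (mat 1, 0) :: 'a affine measure)"
    by (simp add: prob_space_return)
  show ?L
  proof (rule borel_prob_eqI)
    fix f :: "'a affine \<Rightarrow> ennreal" assume f [measurable]: "f \<in> borel_measurable borel"
    have "(\<lambda>g. \<integral>\<^sup>+h. f (affine_comp g h) \<partial>p) \<in> borel_measurable borel"
      by (rule borel_measurable_nn_integral_borel[OF p]) measurable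
    thus "(\<integral>\<^sup>+x. f x \<partial>affine_conv (return borel (mat 1, 0)) p) = (\<integral>\<^sup>+x. f x \<partial>p)"
      using p one by (simp add: nn_integral_affine_conv nn_integral_return)
  qed (simp_all add: affine_conv_def p)
  show ?R
  proof (rule borel_prob_eqI)
    fix f :: "'a affine \<Rightarrow> ennreal" assume f [measurable]: "f \<in> borel_measurable borel"
    show "(\<integral>\<^sup>+x. f x \<partial>affine_conv p (return borel (mat 1, 0))) = (\<integral>\<^sup>+x. f x \<partial>p)"
      using p one by (simp add: nn_integral_affine_conv nn_integral_return)
  qed (simp_all add: affine_conv_def p)
qed

lemma affine_power_add:
  assumes p: "borel_prob p"
  shows "affine_power p (m + n) = affine_conv (affine_power p m) (affine_power p n)"
  by (induction m) (simp_all add: affine_conv_one affine_conv_assoc borel_prob_affine_power p)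

lemma affine_push_power_Suc:
  assumes "borel_prob p" "borel_prob \<nu>"
  shows "affine_push (affine_power p (Suc n)) \<nu> = affine_push p (affine_push (affine_power p n) \<nu>)"
  using assms by (simp add: affine_push_conv borel_prob_affine_power)

lemma affine_push_one:
  assumes \<nu>: "borel_prob \<nu>"
  shows "affine_push (return borel (mat 1, 0)) \<nu> = \<nu>"
proof (rule borel_prob_eqI)
  fix f :: "'a sqmat \<Rightarrow> ennreal" assume f [measurable]: "f \<in> borel_measurable borel"
  have "(\<lambda>g. \<integral>\<^sup>+h. f (affine_map g h) \<partial>\<nu>) \<in> borel_measurable borel"
    by (rule borel_measurable_nn_integral_borel[OF \<nu>]) measurable
  thus "(\<integral>\<^sup>+x. f x \<partial>affine_push (return borel (mat 1, 0)) \<nu>) = (\<integral>\<^sup>+x. f x \<partial>\<nu>)"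
    using \<nu> by (simp add: nn_integral_affine_push nn_integral_return prob_space_return affine_map_def)
qed (simp_all add: affine_push_def \<nu>)

lemma affine_push_power_fixed:
  assumes "borel_prob p" "borel_prob \<nu>" "affine_push p \<nu> = \<nu>"
  shows "affine_push (affine_power p n) \<nu> = \<nu>"
proof (induction n)
  case (Suc n)
  show ?case using affine_push_power_Suc[OF assms(1,2), of n] Suc assms(3) by simp
qed (simp add: affine_push_one assms)

section \<open>Orthogonally invariant laws\<close>

definition orth_invariant :: "'n::finite sqmat measure \<Rightarrow> bool" where
  "orth_invariant \<nu> \<longleftrightarrow> (\<forall>u. orthogonal_matrix u \<longrightarrow> distr \<nu> borel (congr u) = \<nu>)"

text \<open>
  The law of \<open>P Z P\<^sup>T\<close> depends on \<open>P P\<^sup>T\<close> only, since \<open>P = Q U\<close> with \<open>U\<close> orthogonal. The matrix \<open>U\<close> is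
  needed for one fixed pair \<open>P\<close>, \<open>Q\<close> at a time, so that it never has to be a measurable function of
  them.
\<close>
lemma orth_invariant_equal_gram:
  fixes P Q :: "real^'n^'k"
  assumes \<nu>: "borel_prob \<nu>" "orth_invariant \<nu>" and PQ: "P ** transpose P = Q ** transpose Q"
    and f [measurable]: "f \<in> borel_measurable borel"
  shows "(\<integral>\<^sup>+z. f (congr P z) \<partial>\<nu>) = (\<integral>\<^sup>+z. f (congr Q z) \<partial>\<nu>)"
proof -
  have [measurable_cong]: "sets \<nu> = sets borel" using \<nu> by simp
  obtain U where U: "orthogonal_matrix U" "P = Q ** U" using equal_gram_matrices[OF PQ] .
  have "(\<integral>\<^sup>+z. f (congr Q z) \<partial>\<nu>) = (\<integral>\<^sup>+z. f (congr Q z) \<partial>distr \<nu> borel (congr U))"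
    using \<nu>(2) U(1) by (simp add: orth_invariant_def)
  also have "\<dots> = (\<integral>\<^sup>+z. f (congr P z) \<partial>\<nu>)"
    by (subst nn_integral_distr) (simp_all add: U(2) congr_mult)
  finally show ?thesis by simp
qed

text \<open>
  The hypothesis \<open>inv\<close> concerns the pair \<open>(A A\<^sup>T, B)\<close>, and not \<open>(A, B)\<close>. It suffices: by the previous
  lemma the law of \<open>u (a Z a\<^sup>T + b) u\<^sup>T\<close> for fixed \<open>(a, b)\<close> depends on \<open>u a a\<^sup>T u\<^sup>T\<close> and \<open>u b u\<^sup>T\<close> only.
\<close>
lemma orth_invariant_affine_push:
  fixes p :: "'n::finite affine measure"
  assumes p: "borel_prob p"
    and inv: "\<And>u. orthogonal_matrix u \<Longrightarrow>
      distr p borel (\<lambda>g. (congr u (fst g ** transpose (fst g)), congr u (snd g))) =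
      distr p borel (\<lambda>g. (fst g ** transpose (fst g), snd g))"
    and \<nu>: "borel_prob \<nu>" "orth_invariant \<nu>"
  shows "orth_invariant (affine_push p \<nu>)"
  unfolding orth_invariant_def
proof (intro allI impI borel_prob_eqI)
  fix u :: "'n sqmat" and f :: "'n sqmat \<Rightarrow> ennreal"
  assume u: "orthogonal_matrix u" and f [measurable]: "f \<in> borel_measurable borel"
  have [measurable_cong]: "sets p = sets borel" "sets \<nu> = sets borel" "sets (affine_push p \<nu>) = sets borel"
    using \<nu> p by (simp_all add: affine_push_def)
  have fsm: "fst \<in> borel_measurable (borel :: 'n affine measure)"
     "snd \<in> borel_measurable (borel :: 'n affine measure)"
    by (simp_all add: borel_prod[symmetric])
  note [measurable] = fsm
  \<comment> \<open>\<open>G (S, b)\<close> is the integral of \<open>f\<close> against the law of \<open>r Z r\<^sup>T + b\<close> for any \<open>r\<close> with \<open>r r\<^sup>T = S\<close>;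
    taking for \<open>r\<close> the positive semidefinite root makes \<open>G\<close> measurable.\<close>
  define G where "G g = (\<integral>\<^sup>+z. f (affine_map (psd_root (fst g), snd g) z) \<partial>\<nu>)" for g
  have [measurable]: "G \<in> borel_measurable borel"
    unfolding G_def by (rule borel_measurable_nn_integral_borel[OF \<nu>(1)]) measurable
  have G: "(\<integral>\<^sup>+g. \<integral>\<^sup>+z. f (congr J (affine_map g z)) \<partial>\<nu> \<partial>p) =
      (\<integral>\<^sup>+g. G (congr J (fst g ** transpose (fst g)), congr J (snd g)) \<partial>p)" for J :: "'n sqmat"
  proof (rule nn_integral_cong)
    fix g :: "'n affine"
    let ?S = "congr J (fst g ** transpose (fst g))"
    have S: "?S = (J ** fst g) ** transpose (J ** fst g)"
      by (simp add: congr_def matrix_transpose_mul matrix_mul_assoc)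
    hence "pos_semidef ?S" by (simp add: pos_semidef_gram)
    hence root: "(J ** fst g) ** transpose (J ** fst g) = psd_root ?S ** transpose (psd_root ?S)"
      using S psd_root_gram by metis
    have m: "(\<lambda>y. f (y + congr J (snd g))) \<in> borel_measurable borel" by measurable
    show "(\<integral>\<^sup>+z. f (congr J (affine_map g z)) \<partial>\<nu>) = G (?S, congr J (snd g))"
      using orth_invariant_equal_gram[OF \<nu> root m]
      by (simp add: G_def affine_map_def congr_add congr_mult)
  qed
  have "(\<integral>\<^sup>+x. f x \<partial>distr (affine_push p \<nu>) borel (congr u)) = (\<integral>\<^sup>+x. f (congr u x) \<partial>affine_push p \<nu>)"
    by (subst nn_integral_distr) auto
  also have "\<dots> = (\<integral>\<^sup>+g. \<integral>\<^sup>+z. f (congr u (affine_map g z)) \<partial>\<nu> \<partial>p)"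
    by (rule nn_integral_affine_push[OF p \<nu>(1)]) measurable
  also have "\<dots> = (\<integral>\<^sup>+g. G g \<partial>distr p borel (\<lambda>g. (congr u (fst g ** transpose (fst g)), congr u (snd g))))"
    unfolding G by (subst nn_integral_distr) auto
  also have "\<dots> = (\<integral>\<^sup>+g. G g \<partial>distr p borel (\<lambda>g. (fst g ** transpose (fst g), snd g)))"
    by (simp add: inv[OF u])
  also have "\<dots> = (\<integral>\<^sup>+g. \<integral>\<^sup>+z. f (congr (mat 1) (affine_map g z)) \<partial>\<nu> \<partial>p)"
    unfolding G by (subst nn_integral_distr) auto
  also have "\<dots> = (\<integral>\<^sup>+x. f x \<partial>affine_push p \<nu>)"
    by (simp add: nn_integral_affine_push[OF p \<nu>(1)])
  finally show "(\<integral>\<^sup>+x. f x \<partial>distr (affine_push p \<nu>) borel (congr u)) = (\<integral>\<^sup>+x. f x \<partial>affine_push p \<nu>)" .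
qed (simp_all add: affine_push_def)

lemma orth_invariant_return_0: "orth_invariant (return borel 0)"
proof -
  have "distr (return borel 0) borel (congr u) = return borel 0" for u :: "'a sqmat"
    by (subst distr_return) auto
  thus ?thesis by (simp add: orth_invariant_def)
qed

lemma orth_invariant_affine_push_power:
  fixes p :: "'n::finite affine measure"
  assumes p: "borel_prob p"
    and inv: "\<And>u. orthogonal_matrix u \<Longrightarrow>
      distr p borel (\<lambda>g. (congr u (fst g ** transpose (fst g)), congr u (snd g))) =
      distr p borel (\<lambda>g. (fst g ** transpose (fst g), snd g))"
  shows "orth_invariant (affine_push (affine_power p n) (return borel 0))"
proof -
  have zero: "borel_prob (return borel (0 :: 'n sqmat))" by (simp add: prob_space_return)
  show ?thesis
  proof (induction n)
    case 0
    show ?case by (simp add: affine_push_one zero orth_invariant_return_0)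
  next
    case (Suc n)
    show ?case
      unfolding affine_push_power_Suc[OF p zero]
      by (intro orth_invariant_affine_push p inv Suc borel_prob_affine_push
          borel_prob_affine_power zero)
  qed
qed

section \<open>Contraction of long products\<close>

text \<open>
  The square of the operator norm of \<open>c\<close>, written as it appears in the Lyapunov exponent.
\<close>
definition sq_op_norm :: "real^'n^'n \<Rightarrow> real" where
  "sq_op_norm c = lambda_max (c ** transpose c)"

lemma sq_op_norm_le_iff: "sq_op_norm c \<le> t \<longleftrightarrow> (\<forall>v. (transpose c *v v) \<bullet> (transpose c *v v) \<le> t * (v \<bullet> v))"
proof -
  have "v \<bullet> ((c ** transpose c) *v v) = (transpose c *v v) \<bullet> (transpose c *v v)" for v
    by (simp add: matrix_vector_mul_assoc[symmetric] inner_matrix_vector_transpose)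
  thus ?thesis
    using pos_semidef_gram[of c] by (simp add: sq_op_norm_def lambda_max_le_iff pos_semidef_def)
qed

lemma sq_op_norm_bound: "(transpose c *v v) \<bullet> (transpose c *v v) \<le> sq_op_norm c * (v \<bullet> v)"
  using sq_op_norm_le_iff[of c "sq_op_norm c"] by simp

lemma sq_op_norm_nonneg: "0 \<le> sq_op_norm (c :: real^'n^'n)"
proof -
  have "0 \<le> sq_op_norm c * (axis i 1 \<bullet> (axis i 1 :: real^'n))" for i
    using sq_op_norm_bound[of c "axis i 1"] by (meson inner_ge_zero order_trans)
  thus ?thesis by (simp add: inner_axis_axis)
qed

lemma sq_op_norm_mult_le: "sq_op_norm (c ** d) \<le> sq_op_norm c * sq_op_norm d"
  unfolding sq_op_norm_le_iff
proof
  fix v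
  have "(transpose (c ** d) *v v) \<bullet> (transpose (c ** d) *v v)
      \<le> sq_op_norm d * ((transpose c *v v) \<bullet> (transpose c *v v))"
    using sq_op_norm_bound[of d "transpose c *v v"]
    by (simp add: matrix_transpose_mul matrix_vector_mul_assoc[symmetric])
  also have "\<dots> \<le> sq_op_norm d * (sq_op_norm c * (v \<bullet> v))"
    by (intro mult_left_mono sq_op_norm_bound sq_op_norm_nonneg)
  finally show "(transpose (c ** d) *v v) \<bullet> (transpose (c ** d) *v v) \<le> sq_op_norm c * sq_op_norm d * (v \<bullet> v)"
    by (simp add: mult_ac)
qed

lemma sq_op_norm_mat_1_le: "sq_op_norm (mat 1 :: real^'n^'n) \<le> 1"
  by (simp add: sq_op_norm_le_iff)

lemma borel_measurable_sq_op_norm [measurable]: "(sq_op_norm :: real^'n^'n \<Rightarrow> real) \<in> borel_measurable borel"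
proof -
  have "closed {c :: real^'n^'n. sq_op_norm c \<le> t}" for t
  proof -
    have "{c :: real^'n^'n. sq_op_norm c \<le> t} = {c. \<forall>v.
        (\<chi> i. transpose c $ i \<bullet> v) \<bullet> (\<chi> i. transpose c $ i \<bullet> v) \<le> t * (v \<bullet> v)}"
      by (simp add: sq_op_norm_le_iff matrix_mult_dot)
    also have "closed \<dots>"
      by (intro closed_Collect_all closed_Collect_le continuous_intros)
    finally show ?thesis .
  qed
  thus ?thesis unfolding borel_measurable_iff_le by (simp add: borel_closed)
qed

lemma norm_congr_le:
  "norm (congr c y) \<le> real CARD('n) * real CARD('n) * (sq_op_norm c * norm y)" for c y :: "real^'n^'n"
proof (rule norm_matrix_le_entries)
  fix i j
  let ?v = "transpose c *v axis i 1" and ?w = "transpose c *v axis j 1"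
  have sq: "norm (transpose c *v axis k 1) \<le> sqrt (sq_op_norm c)" for k :: 'n
    using sq_op_norm_bound[of c "axis k 1"]
    by (intro real_le_rsqrt) (simp add: power2_norm_eq_inner inner_axis_axis)
  have "congr c y $ i $ j = ?v \<bullet> (y *v ?w)"
    unfolding matrix_entry_inner congr_def
    by (simp add: matrix_vector_mul_assoc[symmetric] inner_matrix_vector_transpose)
  hence "\<bar>congr c y $ i $ j\<bar> \<le> norm ?v * norm (y *v ?w)"
    by (simp add: Cauchy_Schwarz_ineq2)
  also have "\<dots> \<le> norm ?v * (norm y * norm ?w)"
    by (intro mult_left_mono norm_matrix_vector_mult_le) simp
  also have "\<dots> \<le> sqrt (sq_op_norm c) * (norm y * sqrt (sq_op_norm c))"
    by (intro mult_mono sq mult_nonneg_nonneg real_sqrt_ge_zero sq_op_norm_nonneg) auto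
  also have "\<dots> = sq_op_norm c * norm y"
    using sq_op_norm_nonneg[of c] by (simp add: mult_ac)
  finally show "\<bar>congr c y $ i $ j\<bar> \<le> sq_op_norm c * norm y" .
qed

text \<open>
  A Chernoff bound for the norm of a product of \<open>m\<close> independent factors, where \<open>Y\<close> dominates the
  logarithm of the squared norm of one factor. Exponential moments of \<open>Y\<close> need not exist, so \<open>Y\<close> is cut
  off at a level \<open>K\<close>, and the event that some factor exceeds the cutoff is paid for by the first
  summand. The proof is by induction on \<open>m\<close>: condition on the outermost factor \<open>g\<close>, and apply the
  hypothesis to the remaining ones with \<open>\<tau> - Y g\<close> in place of \<open>\<tau>\<close>; this is why \<open>\<tau>\<close> is arbitrary.
\<close>
lemma affine_power_tail_bound:
  fixes Y :: "'n::finite affine \<Rightarrow> real"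
  assumes q: "borel_prob q" and Y [measurable]: "Y \<in> borel_measurable borel"
    and dom_Y: "\<And>g. sq_op_norm (fst g) \<le> exp (Y g)" and s: "s > 0"
  shows "emeasure (affine_power q m) {g. exp \<tau> < sq_op_norm (fst g)}
    \<le> of_nat m * emeasure q {g. K < Y g} +
       ennreal (exp (- s * \<tau>)) * (\<integral>\<^sup>+g. ennreal (exp (s * min (Y g) K)) \<partial>q) ^ m"
  (is "_ \<le> of_nat m * ?a + _ * ?r ^ m")
proof (induction m arbitrary: \<tau>)
  case 0
  have [measurable]: "fst \<in> borel_measurable (borel :: 'n affine measure)"
    by (simp add: borel_prod[symmetric])
  have [measurable]: "{g :: 'n affine. exp \<tau> < sq_op_norm (fst g)} \<in> sets borel" by measurable
  have "emeasure (return borel (mat 1, 0)) {g :: 'n affine. exp \<tau> < sq_op_norm (fst g)} \<le> ennreal (exp (- s * \<tau>))"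
  proof (cases "\<tau> < 0")
    case True
    hence "1 \<le> exp (- s * \<tau>)" using s by (simp add: mult_nonneg_nonpos)
    moreover have "emeasure (return borel (mat 1, 0)) {g :: 'n affine. exp \<tau> < sq_op_norm (fst g)} \<le> 1"
      by (simp add: emeasure_return indicator_def)
    ultimately show ?thesis by (meson ennreal_1 ennreal_leI order_trans dual_order.trans ennreal_ge_1)
  next
    case False
    hence "\<not> exp \<tau> < sq_op_norm (mat 1 :: real^'n^'n)"
      using sq_op_norm_mat_1_le[where 'n='n] by (meson le_less_trans not_le one_le_exp_iff order_trans)
    thus ?thesis by (simp add: emeasure_return)
  qed
  thus ?case by simp
next
  case (Suc m)
  have [measurable]: "fst \<in> borel_measurable (borel :: 'n affine measure)"
    by (simp add: borel_prod[symmetric])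
  have [measurable_cong]: "sets q = sets borel" "sets (affine_power q m) = sets borel"
    using q borel_prob_affine_power[OF q] by auto
  let ?S = "affine_power q m"
  have S: "borel_prob ?S" by (rule borel_prob_affine_power[OF q])
  have "emeasure (affine_power q (Suc m)) {g. exp \<tau> < sq_op_norm (fst g)} =
      (\<integral>\<^sup>+g. indicator {g. exp \<tau> < sq_op_norm (fst g)} g \<partial>affine_conv q ?S)"
    by (simp add: affine_conv_def)
  also have "\<dots> = (\<integral>\<^sup>+g. \<integral>\<^sup>+h. indicator {g. exp \<tau> < sq_op_norm (fst g)} (affine_comp g h) \<partial>?S \<partial>q)"
    by (rule nn_integral_affine_conv[OF q S]) measurable
  also have "\<dots> \<le> (\<integral>\<^sup>+g. indicator {g. K < Y g} g + (of_nat m * ?a +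
       ennreal (exp (- s * \<tau>)) * ?r ^ m * ennreal (exp (s * min (Y g) K))) \<partial>q)"
  proof (rule nn_integral_mono)
    fix g
    have "(\<integral>\<^sup>+h. indicator {g. exp \<tau> < sq_op_norm (fst g)} (affine_comp g h) \<partial>?S)
        \<le> (\<integral>\<^sup>+h. indicator {h. exp (\<tau> - Y g) < sq_op_norm (fst h)} h \<partial>?S)"
    proof (rule nn_integral_mono)
      fix h :: "'n affine"
      have "exp (\<tau> - Y g) < sq_op_norm (fst h)" if "exp \<tau> < sq_op_norm (fst g ** fst h)"
      proof -
        have "exp \<tau> < exp (Y g) * sq_op_norm (fst h)"
          using that sq_op_norm_mult_le[of "fst g" "fst h"]
            mult_right_mono[OF dom_Y[of g] sq_op_norm_nonneg[of "fst h"]] by linarith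
        thus ?thesis by (simp add: exp_diff field_simps)
      qed
      thus "indicator {g. exp \<tau> < sq_op_norm (fst g)} (affine_comp g h)
          \<le> (indicator {h. exp (\<tau> - Y g) < sq_op_norm (fst h)} h :: ennreal)"
        by (auto simp: indicator_def affine_comp_def)
    qed
    also have "\<dots> = emeasure ?S {h. exp (\<tau> - Y g) < sq_op_norm (fst h)}"
      by (subst nn_integral_indicator) measurable
    finally have *: "(\<integral>\<^sup>+h. indicator {g. exp \<tau> < sq_op_norm (fst g)} (affine_comp g h) \<partial>?S)
        \<le> emeasure ?S {h. exp (\<tau> - Y g) < sq_op_norm (fst h)}" .
    show "(\<integral>\<^sup>+h. indicator {g. exp \<tau> < sq_op_norm (fst g)} (affine_comp g h) \<partial>?S)
        \<le> indicator {g. K < Y g} g + (of_nat m * ?a +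
          ennreal (exp (- s * \<tau>)) * ?r ^ m * ennreal (exp (s * min (Y g) K)))"
    proof (cases "K < Y g")
      case True
      have "emeasure ?S {h. exp (\<tau> - Y g) < sq_op_norm (fst h)} \<le> 1"
        using S by (intro prob_space.emeasure_le_1) auto
      also have "1 \<le> (indicator {g. K < Y g} g :: ennreal) + x" for x
        using True by simp
      finally show ?thesis using * by (meson order_trans)
    next
      case False
      have "exp (- s * (\<tau> - Y g)) = exp (- s * \<tau>) * exp (s * min (Y g) K)"
        using False by (simp add: exp_add[symmetric] algebra_simps)
      hence "emeasure ?S {h. exp (\<tau> - Y g) < sq_op_norm (fst h)} \<le> of_nat m * ?a +
          ennreal (exp (- s * \<tau>)) * ?r ^ m * ennreal (exp (s * min (Y g) K))"
        using Suc.IH[of "\<tau> - Y g"] by (simp add: ennreal_mult mult_ac)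
      thus ?thesis using * by (simp add: False)
    qed
  qed
  also have "\<dots> = ?a + (of_nat m * ?a + ennreal (exp (- s * \<tau>)) * ?r ^ m * ?r)"
  proof -
    have "(\<integral>\<^sup>+g. of_nat m * ?a \<partial>q) = of_nat m * ?a"
      using q by (simp add: prob_space.emeasure_space_1)
    thus ?thesis by (simp add: nn_integral_add nn_integral_cmult)
  qed
  also have "\<dots> = of_nat (Suc m) * ?a + ennreal (exp (- s * \<tau>)) * ?r ^ Suc m"
    by (simp add: algebra_simps)
  finally show ?case .
qed

text \<open>
  Lets an integrable function dominate the difference quotients of an exponential moment whose
  exponents are bounded above.
\<close>
lemma exp_minus_one_le: "\<bar>exp u - 1\<bar> \<le> \<bar>u\<bar> * exp c" if "u \<le> c" "0 \<le> c" for u c :: real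
proof (cases "u \<le> 0")
  case True
  have "\<bar>exp u - 1\<bar> = 1 - exp u" using True by simp
  also have "\<dots> \<le> - u" using exp_ge_add_one_self[of u] by linarith
  also have "\<dots> \<le> \<bar>u\<bar> * exp c"
    using True that(2) mult_left_mono[of 1 "exp c" "\<bar>u\<bar>"] by simp
  finally show ?thesis .
next
  case False
  have "\<bar>exp u - 1\<bar> = exp u * (1 - exp (- u))" using False by (simp add: algebra_simps exp_minus)
  also have "\<dots> \<le> exp u * u" using exp_ge_add_one_self[of "- u"] by (intro mult_left_mono) auto
  also have "\<dots> \<le> exp c * u" using False that by simp
  finally show ?thesis using False by (simp add: mult.commute)
qed

text \<open>
  The bound in \<open>affine_power_tail_bound\<close> can be made small when \<open>Y\<close> has negative mean \<open>\<mu>\<close>. Cut off at level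
  \<open>m\<close> and use the exponent \<open>s = c / m\<close>. The tail term tends to \<open>0\<close> because \<open>Y\<close> is integrable. By
  dominated convergence \<open>m * (E exp (s * min Y m) - 1)\<close> tends to \<open>c * \<mu>\<close>, where the cutoff keeps the
  exponents below \<open>c\<close>. So the \<open>m\<close>-th power is at most \<open>exp (c * \<mu>)\<close> in the limit, which is small for
  large \<open>c\<close>, and the factor \<open>exp (- s * \<tau>)\<close> tends to \<open>1\<close>.
\<close>
lemma (in prob_space) truncated_chernoff_limit:
  fixes Y :: "'a \<Rightarrow> real"
  assumes Y: "integrable M Y" "expectation Y < 0" and \<epsilon>: "\<epsilon> > 0"
  shows "\<exists>m::nat. \<exists>s>0. real m * prob {x \<in> space M. real m < Y x} +
    exp (- s * \<tau>) * expectation (\<lambda>x. exp (s * min (Y x) (real m))) ^ m < \<epsilon>"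
proof -
  note [measurable] = borel_measurable_integrable[OF Y(1)]
  define \<mu> where "\<mu> = expectation Y"
  \<comment> \<open>Large enough that \<open>exp (c * \<mu>) < \<epsilon> / 2\<close>.\<close>
  define c where "c = 1 + \<bar>ln (\<epsilon> / 2)\<bar> / (- \<mu>)"
  have \<mu>: "\<mu> < 0" using Y by (simp add: \<mu>_def)
  have c0: "c > 0" using \<mu> by (simp add: c_def add_pos_nonneg divide_nonneg_pos)
  have "c * \<mu> = \<mu> - \<bar>ln (\<epsilon> / 2)\<bar>" using \<mu> by (simp add: c_def field_simps)
  hence "exp (c * \<mu>) < exp (ln (\<epsilon> / 2))" using \<mu> by simp
  hence c: "exp (c * \<mu>) < \<epsilon> / 2" using \<epsilon> by simp
  have tail: "(\<lambda>m. real m * prob {x \<in> space M. real m < Y x}) \<longlonglongrightarrow> 0"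
  proof -
    have "(\<lambda>m. expectation (\<lambda>x. real m * indicator {x \<in> space M. real m < Y x} x)) \<longlonglongrightarrow> expectation (\<lambda>x. 0)"
    proof (rule integral_dominated_convergence[where w="\<lambda>x. \<bar>Y x\<bar>"])
      show "AE x in M. (\<lambda>m. real m * indicator {x \<in> space M. real m < Y x} x) \<longlonglongrightarrow> 0"
      proof (rule AE_I2, rule tendsto_eventually)
        fix x
        have "eventually (\<lambda>m. Y x \<le> real m) sequentially"
          using filterlim_real_sequentially by (simp add: filterlim_at_top)
        thus "eventually (\<lambda>m. real m * indicator {x \<in> space M. real m < Y x} x = 0) sequentially"
          by eventually_elim simp
      qed
    qed (use Y in \<open>auto simp: indicator_def\<close>)
    thus ?thesis by simp
  qed
  define a where "a m = expectation (\<lambda>x. real m * (exp (c / real m * min (Y x) (real m)) - 1))" for m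
  have dom: "\<bar>real m * (exp (c / real m * min (Y x) (real m)) - 1)\<bar> \<le> exp c * c * \<bar>Y x\<bar>" for m x
  proof (cases "m = 0")
    case False
    hence m: "real m > 0" by simp
    have "c / real m * min (Y x) (real m) \<le> c / real m * real m"
      using c0 m by (intro mult_left_mono) auto
    hence le: "c / real m * min (Y x) (real m) \<le> c" using m by simp
    have "\<bar>real m * (exp (c / real m * min (Y x) (real m)) - 1)\<bar> =
        real m * \<bar>exp (c / real m * min (Y x) (real m)) - 1\<bar>"
      by (simp add: abs_mult)
    also have "\<dots> \<le> real m * (\<bar>c / real m * min (Y x) (real m)\<bar> * exp c)"
      using exp_minus_one_le[OF le] c0 by (intro mult_left_mono) auto
    also have "\<dots> = exp c * c * \<bar>min (Y x) (real m)\<bar>"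
      using m c0 by (simp add: abs_mult)
    also have "\<dots> \<le> exp c * c * \<bar>Y x\<bar>"
      using c0 m by (intro mult_left_mono) auto
    finally show ?thesis .
  qed (use c0 in auto)
  have domint: "integrable M (\<lambda>x. exp c * c * \<bar>Y x\<bar>)" using Y(1) by simp
  have "a \<longlonglongrightarrow> expectation (\<lambda>x. c * Y x)"
    unfolding a_def
  proof (rule integral_dominated_convergence[OF _ _ domint])
    show "AE x in M. (\<lambda>m. real m * (exp (c / real m * min (Y x) (real m)) - 1)) \<longlonglongrightarrow> c * Y x"
    proof (rule AE_I2)
      fix x
      have "((\<lambda>t. (exp (t * (c * Y x)) - 1) / t) \<longlongrightarrow> c * Y x) (at 0)"
      proof -
        have "((\<lambda>t. exp (t * (c * Y x))) has_real_derivative exp (0 * (c * Y x)) * (c * Y x)) (at 0)"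
          by (auto intro!: derivative_eq_intros)
        thus ?thesis by (simp add: DERIV_def)
      qed
      hence "(\<lambda>m. (exp (inverse (real (Suc m)) * (c * Y x)) - 1) / inverse (real (Suc m))) \<longlonglongrightarrow> c * Y x"
        by (rule filterlim_compose)
           (use LIMSEQ_inverse_real_of_nat in \<open>auto simp: filterlim_at\<close>)
      hence "(\<lambda>m. (exp (inverse (real m) * (c * Y x)) - 1) / inverse (real m)) \<longlonglongrightarrow> c * Y x"
        by (subst (asm) filterlim_sequentially_Suc)
      moreover have "eventually (\<lambda>m. Y x \<le> real m) sequentially"
        using filterlim_real_sequentially by (simp add: filterlim_at_top)
      hence "eventually (\<lambda>m. (exp (inverse (real m) * (c * Y x)) - 1) / inverse (real m) =
          real m * (exp (c / real m * min (Y x) (real m)) - 1)) sequentially"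
        by eventually_elim (simp add: field_simps)
      ultimately show "(\<lambda>m. real m * (exp (c / real m * min (Y x) (real m)) - 1)) \<longlonglongrightarrow> c * Y x"
        by (rule Lim_transform_eventually)
    qed
    show "AE x in M. norm (real m * (exp (c / real m * min (Y x) (real m)) - 1)) \<le> exp c * c * \<bar>Y x\<bar>" for m
      using dom by simp
  qed measurable
  hence "a \<longlonglongrightarrow> c * \<mu>" by (simp add: \<mu>_def)
  moreover have "(\<lambda>m. - (c / real m) * \<tau>) \<longlonglongrightarrow> 0"
    using tendsto_mult_right[OF lim_const_over_n[of c], of "- \<tau>"] by simp
  ultimately have "(\<lambda>m. real m * prob {x \<in> space M. real m < Y x} +
      exp (- (c / real m) * \<tau>) * exp (a m)) \<longlonglongrightarrow> 0 + exp 0 * exp (c * \<mu>)"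
    by (intro tendsto_intros tail)
  moreover have "0 + exp 0 * exp (c * \<mu>) < \<epsilon>" using c \<epsilon> by simp
  ultimately have "eventually (\<lambda>m. real m * prob {x \<in> space M. real m < Y x} +
      exp (- (c / real m) * \<tau>) * exp (a m) < \<epsilon>) sequentially"
    by (rule order_tendstoD)
  from eventually_happens'[OF sequentially_bot eventually_conj[OF eventually_gt_at_top[of 0] this]]
  obtain m :: nat where m: "m > 0" "real m * prob {x \<in> space M. real m < Y x} +
      exp (- (c / real m) * \<tau>) * exp (a m) < \<epsilon>"
    by blast
  let ?E = "expectation (\<lambda>x. exp (c / real m * min (Y x) (real m)))"
  have "integrable M (\<lambda>x. real m * (exp (c / real m * min (Y x) (real m)) - 1))"
  proof (rule Bochner_Integration.integrable_bound[OF domint])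
    have "\<bar>real m * (exp (c / real m * min (Y x) (real m)) - 1)\<bar> \<le> \<bar>exp c * c * \<bar>Y x\<bar>\<bar>" for x
      using dom[of m x] by linarith
    thus "AE x in M. norm (real m * (exp (c / real m * min (Y x) (real m)) - 1)) \<le>
        norm (exp c * c * \<bar>Y x\<bar>)" by simp
  qed measurable
  hence "integrable M (\<lambda>x. 1 + inverse (real m) * (real m * (exp (c / real m * min (Y x) (real m)) - 1)))"
    by simp
  moreover have "1 + inverse (real m) * (real m * (z - 1)) = z" for z
    using m(1) by (simp add: field_simps)
  ultimately have int: "integrable M (\<lambda>x. exp (c / real m * min (Y x) (real m)))"
    by (simp only:)
  have "a m = real m * (?E - 1)"
    using int by (simp add: a_def prob_space)
  hence "?E = 1 + a m / real m" using m(1) by (simp add: field_simps)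
  also have "\<dots> \<le> exp (a m / real m)" by (rule exp_ge_add_one_self)
  finally have "?E ^ m \<le> exp (a m / real m) ^ m" by (intro power_mono) auto
  also have "\<dots> = exp (a m)" using m(1) by (simp add: exp_of_nat_mult[symmetric])
  finally have "exp (- (c / real m) * \<tau>) * ?E ^ m \<le> exp (- (c / real m) * \<tau>) * exp (a m)"
    by (intro mult_left_mono) auto
  with m(2) have "real m * prob {x \<in> space M. real m < Y x} +
      exp (- (c / real m) * \<tau>) * ?E ^ m < \<epsilon>"
    by linarith
  moreover have "c / real m > 0" using m(1) c0 by simp
  ultimately show ?thesis by blast
qed

lemma affine_power_contracts:
  fixes Y :: "'n::finite affine \<Rightarrow> real"
  assumes q: "borel_prob q" and Y: "integrable q Y" "(\<integral>g. Y g \<partial>q) < 0"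
    and dom_Y: "\<And>g. sq_op_norm (fst g) \<le> exp (Y g)" and "\<epsilon> > 0"
  shows "\<exists>m. emeasure (affine_power q m) {g. exp \<tau> < sq_op_norm (fst g)} < ennreal \<epsilon>"
proof -
  interpret prob_space q using q by simp
  have [measurable_cong]: "sets q = sets borel" using q by simp
  have sp: "space q = UNIV" using sets_eq_imp_space_eq[of q borel] q by simp
  have [measurable]: "Y \<in> borel_measurable borel"
    using borel_measurable_integrable[OF Y(1)] by measurable
  obtain m s where ms: "s > 0" "real m * prob {x \<in> space q. real m < Y x} +
    exp (- s * \<tau>) * expectation (\<lambda>x. exp (s * min (Y x) (real m))) ^ m < \<epsilon>"
    using truncated_chernoff_limit[OF Y \<open>\<epsilon> > 0\<close>] by blast
  have int: "integrable q (\<lambda>x. exp (s * min (Y x) (real m)))"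
    by (rule integrable_const_bound[where B="exp (s * real m)"]) (use ms in auto)
  have "emeasure (affine_power q m) {g. exp \<tau> < sq_op_norm (fst g)} \<le>
      of_nat m * emeasure q {g. real m < Y g} +
       ennreal (exp (- s * \<tau>)) * (\<integral>\<^sup>+g. ennreal (exp (s * min (Y g) (real m))) \<partial>q) ^ m"
    by (rule affine_power_tail_bound[OF q _ dom_Y ms(1)]) measurable
  also have "\<dots> = ennreal (real m * prob {x \<in> space q. real m < Y x} +
    exp (- s * \<tau>) * expectation (\<lambda>x. exp (s * min (Y x) (real m))) ^ m)"
    using int by (simp add: nn_integral_eq_integral emeasure_eq_measure sp ennreal_mult
        ennreal_power[symmetric] ennreal_of_nat_eq_real_of_nat ennreal_plus)
  also have "\<dots> < ennreal \<epsilon>" using ms(2) by (intro ennreal_lessI) (use \<open>\<epsilon> > 0\<close> in auto)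
  finally show ?thesis by blast
qed

section \<open>Fixed laws are orthogonally invariant\<close>

text \<open>
  The indicator of a closed set \<open>F\<close> is the limit of the functions \<open>max 0 (1 - k * infdist x F)\<close>.
\<close>
lemma borel_prob_eqI_uniformly_continuous:
  fixes \<mu> \<nu> :: "'a::metric_space measure"
  assumes \<mu>: "borel_prob \<mu>" and \<nu>: "borel_prob \<nu>"
    and eq: "\<And>f :: 'a \<Rightarrow> real. (\<And>x. 0 \<le> f x) \<Longrightarrow> (\<And>x. f x \<le> 1) \<Longrightarrow>
      uniformly_continuous_on UNIV f \<Longrightarrow> (\<integral>\<^sup>+x. f x \<partial>\<mu>) = (\<integral>\<^sup>+x. f x \<partial>\<nu>)"
  shows "\<mu> = \<nu>"
proof (rule measure_eqI_generator_eq[where E="Collect closed" and \<Omega>=UNIV and A="\<lambda>_. UNIV"])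
  show "Int_stable (Collect closed :: 'a set set)" by (auto simp: Int_stable_def)
  show "sets \<mu> = sigma_sets UNIV (Collect closed)" "sets \<nu> = sigma_sets UNIV (Collect closed)"
    using \<mu> \<nu> by (simp_all add: borel_eq_closed)
  show "emeasure \<mu> UNIV \<noteq> \<infinity>" 
    using \<mu> prob_space.emeasure_le_1[of \<mu> UNIV] by (auto simp: top_unique)
  fix F :: "'a set" assume "F \<in> Collect closed"
  hence F: "closed F" by simp
  show "emeasure \<mu> F = emeasure \<nu> F"
  proof (cases "F = {}")
    case False
    define f where "f k x = max 0 (1 - real k * infdist x F)" for k x
    have uc: "uniformly_continuous_on UNIV (f k)" for k
      unfolding uniformly_continuous_on_def
    proof (intro allI impI)
      fix e :: real assume e: "e > 0"
      show "\<exists>d>0. \<forall>x\<in>UNIV. \<forall>x'\<in>UNIV. dist x' x < d \<longrightarrow> dist (f k x') (f k x) < e"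
      proof (intro exI[of _ "e / (real k + 1)"] conjI ballI impI)
        fix x x' :: 'a assume d: "dist x' x < e / (real k + 1)"
        have "dist (f k x') (f k x) \<le> \<bar>real k * infdist x' F - real k * infdist x F\<bar>"
          unfolding f_def dist_real_def by linarith
        also have "\<dots> = real k * \<bar>infdist x' F - infdist x F\<bar>"
          by (simp add: abs_mult right_diff_distrib[symmetric])
        also have "\<dots> \<le> real k * dist x' x" by (intro mult_left_mono infdist_triangle_abs) simp
        also have "\<dots> \<le> (real k + 1) * dist x' x" by (simp add: mult_right_mono)
        also have "\<dots> < e" using d by (simp add: field_simps)
        finally show "dist (f k x') (f k x) < e" .
      qed (use e in auto)
    qed
    have meas: "f k \<in> borel_measurable borel" for k
      using uc by (intro borel_measurable_continuous_onI uniformly_continuous_imp_continuous)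
    have f01: "0 \<le> f k x" "f k x \<le> 1" for k x
      by (simp_all add: f_def infdist_nonneg)
    have lim: "(\<lambda>k. f k x) \<longlonglongrightarrow> indicator F x" for x
    proof (cases "x \<in> F")
      case True
      thus ?thesis by (simp add: f_def)
    next
      case out: False
      hence pos: "infdist x F > 0" using F False by (intro infdist_pos_not_in_closed)
      have "eventually (\<lambda>k. 1 / infdist x F \<le> real k) sequentially"
        using filterlim_real_sequentially by (simp add: filterlim_at_top)
      hence "eventually (\<lambda>k. f k x = indicator F x) sequentially"
        by eventually_elim (use pos out in \<open>simp add: f_def field_simps\<close>)
      thus ?thesis by (rule tendsto_eventually)
    qed
    have conv: "(\<lambda>k. \<integral>\<^sup>+x. f k x \<partial>\<rho>) \<longlonglongrightarrow> emeasure \<rho> F" if \<rho>: "borel_prob \<rho>" for \<rho> :: "'a measure"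
    proof -
      interpret prob_space \<rho> using \<rho> by simp
      have [measurable_cong]: "sets \<rho> = sets borel" using \<rho> by simp
      note [measurable] = meas borel_closed[OF F]
      have "(\<lambda>k. \<integral>\<^sup>+x. ennreal (f k x) \<partial>\<rho>) \<longlonglongrightarrow> (\<integral>\<^sup>+x. ennreal (indicator F x) \<partial>\<rho>)"
      proof (rule nn_integral_dominated_convergence[where w="\<lambda>_. 1"])
        show "AE x in \<rho>. (\<lambda>k. ennreal (f k x)) \<longlonglongrightarrow> ennreal (indicator F x)"
          by (intro AE_I2 tendsto_ennrealI lim)
      qed (use f01 in \<open>auto simp: emeasure_space_1 ennreal_le_1\<close>)
      thus ?thesis by (simp add: ennreal_indicator)
    qed
    show ?thesis
      using LIMSEQ_unique[OF conv[OF \<mu>]] conv[OF \<nu>] eq[OF f01 uc] by simp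
  qed simp
qed auto

text \<open>
  Applying the same random map \<open>z \<mapsto> c z c\<^sup>T + x\<close> to a point \<open>z\<close> with law \<open>\<mu>\<close> and to \<open>0\<close> gives points
  that differ by \<open>c z c\<^sup>T\<close>. This is shorter than \<open>\<delta>\<close> unless \<open>c\<close> or \<open>z\<close> is large, which happens with
  probability at most \<open>2 * \<epsilon>\<close>; the remaining \<open>\<epsilon>\<close> comes from the continuity of \<open>f\<close>.
\<close>
lemma affine_push_near_orbit_of_0:
  fixes R :: "'n::finite affine measure" and f :: "'n sqmat \<Rightarrow> real"
  assumes R: "borel_prob R" and \<mu>: "borel_prob \<mu>" and f [measurable]: "f \<in> borel_measurable borel"
    and f01: "\<And>x. 0 \<le> f x" "\<And>x. f x \<le> 1"
    and fd: "\<And>x y. dist x y < \<delta> \<Longrightarrow> \<bar>f x - f y\<bar> \<le> \<epsilon>" and \<epsilon>: "0 \<le> \<epsilon>"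
    and small: "emeasure R {g. exp \<tau> < sq_op_norm (fst g)} \<le> ennreal \<epsilon>"
    and K: "emeasure \<mu> {z. K < norm z} \<le> ennreal \<epsilon>"
    and \<delta>: "real CARD('n) * real CARD('n) * (exp \<tau> * K) < \<delta>"
  shows "(\<integral>\<^sup>+x. f x \<partial>affine_push R \<mu>) \<le> (\<integral>\<^sup>+x. f x \<partial>affine_push R (return borel 0)) + ennreal (3 * \<epsilon>)"
    and "(\<integral>\<^sup>+x. f x \<partial>affine_push R (return borel 0)) \<le> (\<integral>\<^sup>+x. f x \<partial>affine_push R \<mu>) + ennreal (3 * \<epsilon>)"
proof -
  interpret R: prob_space R using R by simp
  interpret \<mu>: prob_space \<mu> using \<mu> by simp
  have [measurable_cong]: "sets R = sets borel" "sets \<mu> = sets borel" using R \<mu> by auto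
  have [measurable]: "fst \<in> borel_measurable (borel :: 'n affine measure)"
    "snd \<in> borel_measurable (borel :: 'n affine measure)"
    by (simp_all add: borel_prod[symmetric])
  have zero: "borel_prob (return borel (0 :: 'n sqmat))" by (simp add: prob_space_return)
  \<comment> \<open>A pointwise bound for the difference of the two integrands.\<close>
  define e where "e g z = ennreal \<epsilon> + indicator {g. exp \<tau> < sq_op_norm (fst g)} g + indicator {z. K < norm z} z"
    for g :: "'n affine" and z :: "'n sqmat"
  have close: "\<bar>f (affine_map g z) - f (snd g)\<bar> \<le> \<epsilon>"
    if "\<not> exp \<tau> < sq_op_norm (fst g)" "\<not> K < norm z" for g z
  proof (rule fd)
    have "dist (affine_map g z) (snd g) = norm (congr (fst g) z)"
      by (simp add: affine_map_def dist_norm)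
    also have "\<dots> \<le> real CARD('n) * real CARD('n) * (sq_op_norm (fst g) * norm z)"
      by (rule norm_congr_le)
    also have "\<dots> \<le> real CARD('n) * real CARD('n) * (exp \<tau> * K)"
      using that by (intro mult_left_mono mult_mono) auto
    finally show "dist (affine_map g z) (snd g) < \<delta>" using \<delta> by linarith
  qed
  have bound: "ennreal (f x) \<le> ennreal (f y) + e g z"
    if "\<bar>f x - f y\<bar> \<le> \<epsilon> \<or> exp \<tau> < sq_op_norm (fst g) \<or> K < norm z" for x y g z
  proof (cases "exp \<tau> < sq_op_norm (fst g) \<or> K < norm z")
    case True
    have "1 \<le> e g z"
    proof (cases "exp \<tau> < sq_op_norm (fst g)")
      case False
      thus ?thesis using True by (simp add: e_def)
    qed (simp add: e_def add.commute add.left_commute)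
    moreover have "ennreal (f x) \<le> 1" using f01 by (simp add: ennreal_le_1)
    ultimately show ?thesis by (meson add_increasing order_trans zero_le)
  next
    case False
    hence "f x \<le> f y + \<epsilon>" using that by linarith
    hence "ennreal (f x) \<le> ennreal (f y) + ennreal \<epsilon>"
      using f01 \<epsilon> by (simp add: ennreal_plus[symmetric] ennreal_leI del: ennreal_plus)
    also have "\<dots> \<le> ennreal (f y) + e g z" by (simp add: e_def add.assoc)
    finally show ?thesis .
  qed
  have up: "ennreal (f (affine_map g z)) \<le> ennreal (f (snd g)) + e g z"
    and down: "ennreal (f (snd g)) \<le> ennreal (f (affine_map g z)) + e g z" for g z
  proof -
    have *: "\<bar>f (affine_map g z) - f (snd g)\<bar> \<le> \<epsilon> \<or> exp \<tau> < sq_op_norm (fst g) \<or> K < norm z"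
      using close[of g z] by blast
    thus "ennreal (f (affine_map g z)) \<le> ennreal (f (snd g)) + e g z" by (rule bound)
    show "ennreal (f (snd g)) \<le> ennreal (f (affine_map g z)) + e g z"
      by (rule bound) (use * in \<open>simp only: abs_minus_commute[of "f (snd g)"]\<close>)
  qed
  have e_total: "(\<integral>\<^sup>+g. \<integral>\<^sup>+z. e g z \<partial>\<mu> \<partial>R) \<le> ennreal (3 * \<epsilon>)"
  proof -
    have "(\<integral>\<^sup>+g. \<integral>\<^sup>+z. e g z \<partial>\<mu> \<partial>R) =
        (\<integral>\<^sup>+g. ennreal \<epsilon> + indicator {g. exp \<tau> < sq_op_norm (fst g)} g + emeasure \<mu> {z. K < norm z} \<partial>R)"
      unfolding e_def by (subst nn_integral_add) (auto simp: \<mu>.emeasure_space_1)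
    also have "\<dots> = ennreal \<epsilon> + emeasure R {g. exp \<tau> < sq_op_norm (fst g)} + emeasure \<mu> {z. K < norm z}"
      by (simp add: nn_integral_add R.emeasure_space_1)
    also have "\<dots> \<le> ennreal \<epsilon> + ennreal \<epsilon> + ennreal \<epsilon>" by (intro add_mono small K) simp
    also have "\<dots> = ennreal (3 * \<epsilon>)" using \<epsilon> by (simp add: ennreal_plus[symmetric] del: ennreal_plus)
    finally show ?thesis .
  qed
  have [measurable]: "(\<lambda>g. \<integral>\<^sup>+z. ennreal (f (affine_map g z)) \<partial>\<mu>) \<in> borel_measurable borel"
    by (rule borel_measurable_nn_integral_borel[OF \<mu>]) measurable
  have [measurable]: "(\<lambda>g. \<integral>\<^sup>+z. e g z \<partial>\<mu>) \<in> borel_measurable borel"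
    by (rule borel_measurable_nn_integral_borel[OF \<mu>]) (unfold e_def, measurable)
  have em [measurable]: "e g \<in> borel_measurable borel" for g
    unfolding e_def by measurable
  have I\<mu>: "(\<integral>\<^sup>+x. f x \<partial>affine_push R \<mu>) = (\<integral>\<^sup>+g. \<integral>\<^sup>+z. f (affine_map g z) \<partial>\<mu> \<partial>R)"
    by (rule nn_integral_affine_push[OF R \<mu>]) measurable
  have I0: "(\<integral>\<^sup>+x. f x \<partial>affine_push R (return borel 0)) = (\<integral>\<^sup>+g. f (snd g) \<partial>R)"
    by (subst nn_integral_affine_push[OF R zero]) (auto simp: nn_integral_return affine_map_def)
  have "(\<integral>\<^sup>+g. \<integral>\<^sup>+z. f (affine_map g z) \<partial>\<mu> \<partial>R) \<le> (\<integral>\<^sup>+g. \<integral>\<^sup>+z. ennreal (f (snd g)) + e g z \<partial>\<mu> \<partial>R)"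
    by (intro nn_integral_mono up)
  also have "\<dots> = (\<integral>\<^sup>+g. f (snd g) \<partial>R) + (\<integral>\<^sup>+g. \<integral>\<^sup>+z. e g z \<partial>\<mu> \<partial>R)"
    by (simp add: nn_integral_add \<mu>.emeasure_space_1)
  finally show "(\<integral>\<^sup>+x. f x \<partial>affine_push R \<mu>) \<le> (\<integral>\<^sup>+x. f x \<partial>affine_push R (return borel 0)) + ennreal (3 * \<epsilon>)"
    unfolding I\<mu> I0 using e_total by (meson add_left_mono order_trans)
  have "(\<integral>\<^sup>+g. f (snd g) \<partial>R) = (\<integral>\<^sup>+g. \<integral>\<^sup>+z. f (snd g) \<partial>\<mu> \<partial>R)"
    by (simp add: \<mu>.emeasure_space_1)
  also have "\<dots> \<le> (\<integral>\<^sup>+g. \<integral>\<^sup>+z. ennreal (f (affine_map g z)) + e g z \<partial>\<mu> \<partial>R)"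
    by (intro nn_integral_mono down)
  also have "\<dots> = (\<integral>\<^sup>+g. \<integral>\<^sup>+z. f (affine_map g z) \<partial>\<mu> \<partial>R) + (\<integral>\<^sup>+g. \<integral>\<^sup>+z. e g z \<partial>\<mu> \<partial>R)"
    by (simp add: nn_integral_add)
  finally show "(\<integral>\<^sup>+x. f x \<partial>affine_push R (return borel 0)) \<le> (\<integral>\<^sup>+x. f x \<partial>affine_push R \<mu>) + ennreal (3 * \<epsilon>)"
    unfolding I\<mu> I0 using e_total by (meson add_left_mono order_trans)
qed

lemma borel_prob_tight:
  fixes \<mu> :: "'a::real_normed_vector measure"
  assumes \<mu>: "borel_prob \<mu>" and "\<epsilon> > 0"
  obtains K where "K > 0" "emeasure \<mu> {z. K < norm z} \<le> ennreal \<epsilon>"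
proof -
  interpret prob_space \<mu> using \<mu> by simp
  have "open {z :: 'a. real k < norm z}" for k
    by (intro open_Collect_less continuous_intros)
  hence "range (\<lambda>k. {z. real k < norm z}) \<subseteq> sets \<mu>"
    using \<mu> by auto
  moreover have "decseq (\<lambda>k. {z :: 'a. real k < norm z})"
    by (rule decseq_SucI) auto
  ultimately have "(\<lambda>k. measure \<mu> {z. real k < norm z}) \<longlonglongrightarrow> measure \<mu> (\<Inter>k. {z. real k < norm z})"
    by (rule finite_Lim_measure_decseq)
  moreover have "(\<Inter>k. {z :: 'a. real k < norm z}) = {}"
  proof -
    have "\<exists>k. \<not> real k < norm z" for z :: 'a
      using real_arch_simple[of "norm z"] by (auto simp: not_less)
    thus ?thesis by auto
  qed
  ultimately have "(\<lambda>k. measure \<mu> {z. real k < norm z}) \<longlonglongrightarrow> 0"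
    by (simp only: measure_empty)
  hence "eventually (\<lambda>k. measure \<mu> {z. real k < norm z} < \<epsilon>) sequentially"
    using \<open>\<epsilon> > 0\<close> by (rule order_tendstoD)
  from eventually_happens'[OF sequentially_bot eventually_conj[OF eventually_gt_at_top[of 0] this]]
  obtain k where "k > 0" "measure \<mu> {z. real k < norm z} < \<epsilon>" by blast
  thus thesis by (intro that[of "real k"]) (auto simp: emeasure_eq_measure ennreal_leI)
qed

text \<open>
  A fixed law \<open>\<mu>\<close> is approximated by the laws obtained by iterating from \<open>0\<close>, all of which are invariant.
  Since the iterates of \<open>\<mu>\<close> are \<open>\<mu>\<close> itself, it is enough to find, for every accuracy, a single \<open>n\<close> with
  contracting products. The estimate is applied to \<open>f\<close> and to \<open>f \<circ> congr u\<close> with the same \<open>n\<close>.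
\<close>
lemma orth_invariant_fixed_point:
  fixes p :: "'n::finite affine measure"
  assumes p: "borel_prob p"
    and inv: "\<And>u. orthogonal_matrix u \<Longrightarrow>
      distr p borel (\<lambda>g. (congr u (fst g ** transpose (fst g)), congr u (snd g))) =
      distr p borel (\<lambda>g. (fst g ** transpose (fst g), snd g))"
    and \<mu>: "borel_prob \<mu>" and fixed: "affine_push p \<mu> = \<mu>"
    and contr: "\<And>\<epsilon> \<tau>. \<epsilon> > 0 \<Longrightarrow> \<exists>n. emeasure (affine_power p n) {g. exp \<tau> < sq_op_norm (fst g)} < ennreal \<epsilon>"
  shows "orth_invariant \<mu>"
  unfolding orth_invariant_def
proof (intro allI impI)
  fix u :: "'n sqmat" assume u: "orthogonal_matrix u"
  have [measurable_cong]: "sets \<mu> = sets borel" using \<mu> by simp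
  have lin: "bounded_linear (congr u)"
    unfolding linear_conv_bounded_linear[symmetric]
    by (rule linearI) (simp_all add: congr_add, simp add: congr_def vec_eq_iff matrix_matrix_mult_def sum_distrib_left sum_distrib_right mult_ac)
  show "distr \<mu> borel (congr u) = \<mu>"
  proof (rule borel_prob_eqI_uniformly_continuous[OF _ \<mu>])
    show "borel_prob (distr \<mu> borel (congr u))"
      using \<mu> by (intro borel_prob_distr) auto
    fix f :: "'n sqmat \<Rightarrow> real"
    assume f01: "\<And>x. 0 \<le> f x" "\<And>x. f x \<le> 1" and uc: "uniformly_continuous_on UNIV f"
    define f' where "f' x = f (congr u x)" for x
    have f'01: "\<And>x. 0 \<le> f' x" "\<And>x. f' x \<le> 1" using f01 by (simp_all add: f'_def)
    have uc': "uniformly_continuous_on UNIV f'"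
      using uc bounded_linear.uniformly_continuous_on[OF lin uniformly_continuous_on_id, of UNIV]
      unfolding f'_def uniformly_continuous_on_def by (metis UNIV_I)
    have [measurable]: "f \<in> borel_measurable borel" "f' \<in> borel_measurable borel"
      using uc uc' by (auto intro!: borel_measurable_continuous_onI uniformly_continuous_imp_continuous)
    have close: "(\<integral>\<^sup>+x. f' x \<partial>\<mu>) \<le> (\<integral>\<^sup>+x. f x \<partial>\<mu>) + ennreal e \<and>
      (\<integral>\<^sup>+x. f x \<partial>\<mu>) \<le> (\<integral>\<^sup>+x. f' x \<partial>\<mu>) + ennreal e" if e: "e > 0" for e
    proof -
      \<comment> \<open>Two applications of the estimate, each with error \<open>3 * \<epsilon>\<close>.\<close>
      define \<epsilon> where "\<epsilon> = e / 6"
      have \<epsilon>: "\<epsilon> > 0" using e by (simp add: \<epsilon>_def)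
      obtain d1 where d1: "d1 > 0" "\<And>x y. dist x y < d1 \<Longrightarrow> \<bar>f x - f y\<bar> < \<epsilon>"
        using uc \<epsilon> unfolding uniformly_continuous_on_def by (metis UNIV_I dist_real_def)
      obtain d2 where d2: "d2 > 0" "\<And>x y. dist x y < d2 \<Longrightarrow> \<bar>f' x - f' y\<bar> < \<epsilon>"
        using uc' \<epsilon> unfolding uniformly_continuous_on_def by (metis UNIV_I dist_real_def)
      define \<delta> where "\<delta> = min d1 d2"
      obtain K where K: "K > 0" "emeasure \<mu> {z. K < norm z} \<le> ennreal \<epsilon>"
        using borel_prob_tight[OF \<mu> \<epsilon>] .
      \<comment> \<open>The squared norm of \<open>c\<close> below which \<open>c z c\<^sup>T\<close> is shorter than \<open>\<delta>\<close> for \<open>norm z \<le> K\<close>.\<close>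
      define t where "t = \<delta> / 2 / (real CARD('n) * real CARD('n) * K)"
      have \<delta>0: "\<delta> > 0" using d1 d2 by (simp add: \<delta>_def)
      hence t: "t > 0" using K by (simp add: t_def)
      have "real CARD('n) * real CARD('n) * (exp (ln t) * K) = \<delta> / 2"
        using t K by (simp add: t_def)
      hence \<delta>: "real CARD('n) * real CARD('n) * (exp (ln t) * K) < \<delta>"
        using \<delta>0 by linarith
      obtain n where n: "emeasure (affine_power p n) {g. exp (ln t) < sq_op_norm (fst g)} \<le> ennreal \<epsilon>"
        using contr[OF \<epsilon>, of "ln t"] less_imp_le by blast
      let ?R = "affine_power p n" and ?\<nu> = "affine_push (affine_power p n) (return borel 0)"
      have R: "borel_prob ?R" by (rule borel_prob_affine_power[OF p])
      have fix': "affine_push ?R \<mu> = \<mu>" by (rule affine_push_power_fixed[OF p \<mu> fixed])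
      have fd: "\<bar>f x - f y\<bar> \<le> \<epsilon>" "\<bar>f' x - f' y\<bar> \<le> \<epsilon>" if "dist x y < \<delta>" for x y
        using that d1(2)[of x y] d2(2)[of x y] by (auto simp: \<delta>_def)
      have near: "(\<integral>\<^sup>+x. h x \<partial>\<mu>) \<le> (\<integral>\<^sup>+x. h x \<partial>?\<nu>) + ennreal (3 * \<epsilon>)"
          "(\<integral>\<^sup>+x. h x \<partial>?\<nu>) \<le> (\<integral>\<^sup>+x. h x \<partial>\<mu>) + ennreal (3 * \<epsilon>)" if "h = f \<or> h = f'" for h
        using that affine_push_near_orbit_of_0[OF R \<mu> _ f01 fd(1) less_imp_le[OF \<epsilon>] n K(2) \<delta>]
          affine_push_near_orbit_of_0[OF R \<mu> _ f'01 fd(2) less_imp_le[OF \<epsilon>] n K(2) \<delta>]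
        by (auto simp: fix')
      have "distr ?\<nu> borel (congr u) = ?\<nu>"
        using orth_invariant_affine_push_power[OF p inv] u by (simp add: orth_invariant_def)
      hence "(\<integral>\<^sup>+x. f x \<partial>?\<nu>) = (\<integral>\<^sup>+x. f x \<partial>distr ?\<nu> borel (congr u))" by simp
      also have "\<dots> = (\<integral>\<^sup>+x. f' x \<partial>?\<nu>)"
      proof -
        have [measurable_cong]: "sets ?\<nu> = sets borel" by (simp add: affine_push_def)
        show ?thesis by (subst nn_integral_distr) (auto simp: f'_def)
      qed
      finally have eq: "(\<integral>\<^sup>+x. f x \<partial>?\<nu>) = (\<integral>\<^sup>+x. f' x \<partial>?\<nu>)" .
      have sum: "ennreal (3 * \<epsilon>) + ennreal (3 * \<epsilon>) = ennreal e"
        using \<epsilon> by (simp add: ennreal_plus[symmetric] \<epsilon>_def del: ennreal_plus)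
      have "(\<integral>\<^sup>+x. f' x \<partial>\<mu>) \<le> (\<integral>\<^sup>+x. f x \<partial>?\<nu>) + ennreal (3 * \<epsilon>)"
        unfolding eq by (intro near) simp
      also have "\<dots> \<le> ((\<integral>\<^sup>+x. f x \<partial>\<mu>) + ennreal (3 * \<epsilon>)) + ennreal (3 * \<epsilon>)"
        by (intro add_right_mono near) simp
      finally have 1: "(\<integral>\<^sup>+x. f' x \<partial>\<mu>) \<le> (\<integral>\<^sup>+x. f x \<partial>\<mu>) + ennreal e"
        by (simp only: add.assoc sum)
      have "(\<integral>\<^sup>+x. f x \<partial>\<mu>) \<le> (\<integral>\<^sup>+x. f' x \<partial>?\<nu>) + ennreal (3 * \<epsilon>)"
        unfolding eq[symmetric] by (intro near) simp
      also have "\<dots> \<le> ((\<integral>\<^sup>+x. f' x \<partial>\<mu>) + ennreal (3 * \<epsilon>)) + ennreal (3 * \<epsilon>)"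
        by (intro add_right_mono near) simp
      finally have "(\<integral>\<^sup>+x. f x \<partial>\<mu>) \<le> (\<integral>\<^sup>+x. f' x \<partial>\<mu>) + ennreal e"
        by (simp only: add.assoc sum)
      with 1 show ?thesis by blast
    qed
    have "(\<integral>\<^sup>+x. f' x \<partial>\<mu>) = (\<integral>\<^sup>+x. f x \<partial>\<mu>)"
      using close by (blast intro: antisym[OF ennreal_le_epsilon ennreal_le_epsilon])
    thus "(\<integral>\<^sup>+x. f x \<partial>distr \<mu> borel (congr u)) = (\<integral>\<^sup>+x. f x \<partial>\<mu>)"
      by (subst nn_integral_distr) (auto simp: f'_def)
  qed
qed

section \<open>Negative Lyapunov exponents\<close>

text \<open>
  The logarithm may take the value \<open>-\<infinity>\<close> and may have expectation \<open>-\<infinity>\<close>. Cutting it off from below at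
  \<open>-k\<close> makes it integrable, and by monotone convergence the expectation stays negative for large
  \<open>k\<close>. A negative value of \<open>eexpectation\<close> forces the positive part to have a finite integral.
\<close>
lemma (in prob_space) truncated_log_expectation_neg:
  fixes L :: "'a \<Rightarrow> real"
  assumes [measurable]: "L \<in> borel_measurable M"
    and neg: "eexpectation M (\<lambda>\<omega>. elog (L \<omega>)) < 0"
  obtains k :: nat where "integrable M (\<lambda>\<omega>. ln (max (L \<omega>) (exp (- real k))))"
    "expectation (\<lambda>\<omega>. ln (max (L \<omega>) (exp (- real k)))) < 0"
proof -
  define P where "P = (\<integral>\<^sup>+\<omega>. e2ennreal (elog (L \<omega>)) \<partial>M)"
  define h where "h \<omega> = e2ennreal (- elog (L \<omega>))" for \<omega>
  have h: "h \<omega> = (if L \<omega> \<le> 0 then top else ennreal (- ln (L \<omega>)))" for \<omega>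
    by (simp add: h_def elog_def)
  have [measurable]: "h \<in> borel_measurable M" unfolding h[abs_def] by measurable
  have "enn2ereal P - enn2ereal (\<integral>\<^sup>+\<omega>. h \<omega> \<partial>M) < 0"
    using neg by (simp add: eexpectation_def P_def h_def)
  hence "enn2ereal P < enn2ereal (\<integral>\<^sup>+\<omega>. h \<omega> \<partial>M)"
    by (cases "enn2ereal P"; cases "enn2ereal (\<integral>\<^sup>+\<omega>. h \<omega> \<partial>M)") auto
  hence "P < (\<integral>\<^sup>+\<omega>. h \<omega> \<partial>M)" by (simp add: less_ennreal.rep_eq)
  also have "\<dots> = (\<integral>\<^sup>+\<omega>. (SUP k::nat. inf (h \<omega>) (of_nat k)) \<partial>M)"
    by (simp add: inf_SUP[symmetric] ennreal_SUP_of_nat_eq_top)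
  also have "\<dots> = (SUP k::nat. \<integral>\<^sup>+\<omega>. inf (h \<omega>) (of_nat k) \<partial>M)"
    by (intro nn_integral_monotone_convergence_SUP)
       (auto simp: incseq_def le_fun_def intro: le_infI2)
  finally obtain k where k: "P < (\<integral>\<^sup>+\<omega>. inf (h \<omega>) (of_nat k) \<partial>M)"
    by (auto simp: less_SUP_iff)
  define Y where "Y \<omega> = ln (max (L \<omega>) (exp (- real k)))" for \<omega>
  have [measurable]: "Y \<in> borel_measurable M" unfolding Y_def by measurable
  have Y: "Y \<omega> = (if L \<omega> \<le> exp (- real k) then - real k else ln (L \<omega>))" for \<omega>
    by (simp add: Y_def max_def)
  have ln_le: "ln (L \<omega>) \<le> - real k" if "L \<omega> \<le> exp (- real k)" "L \<omega> > 0" for \<omega>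
    using that by (metis ln_exp ln_mono exp_gt_zero)
  have ln_ge: "- real k \<le> ln (L \<omega>)" "L \<omega> > 0" if "\<not> L \<omega> \<le> exp (- real k)" for \<omega>
  proof -
    show "L \<omega> > 0" using that by (meson exp_gt_zero less_trans not_le)
    thus "- real k \<le> ln (L \<omega>)" using that by (simp add: ln_ge_iff)
  qed
  have pos: "ennreal (Y \<omega>) = e2ennreal (elog (L \<omega>))" for \<omega>
  proof (cases "L \<omega> \<le> exp (- real k)")
    case True
    moreover have "ennreal (ln (L \<omega>)) = 0" if "L \<omega> > 0"
      using ln_le[OF True that] by (intro ennreal_neg) simp
    ultimately show ?thesis by (auto simp: Y elog_def e2ennreal_neg ennreal_neg)
  next
    case False
    thus ?thesis using ln_ge[of \<omega>] by (simp add: Y elog_def)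
  qed
  have negp: "ennreal (- Y \<omega>) = inf (h \<omega>) (of_nat k)" for \<omega>
  proof (cases "L \<omega> \<le> exp (- real k)")
    case True
    show ?thesis
    proof (cases "L \<omega> \<le> 0")
      case True
      hence "L \<omega> \<le> exp (- real k)" by (meson exp_ge_zero order_trans)
      thus ?thesis using True by (simp add: Y h ennreal_of_nat_eq_real_of_nat)
    next
      case False
      hence "real k \<le> - ln (L \<omega>)" using ln_le[of \<omega>] True by simp
      hence "ennreal (real k) \<le> ennreal (- ln (L \<omega>))" by (rule ennreal_leI)
      thus ?thesis using True False
        by (simp add: Y h ennreal_of_nat_eq_real_of_nat inf_absorb2)
    qed
  next
    case False
    hence "- ln (L \<omega>) \<le> real k" "L \<omega> > 0" using ln_ge[of \<omega>] by auto
    hence "ennreal (- ln (L \<omega>)) \<le> ennreal (real k)" by (intro ennreal_leI)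
    thus ?thesis using False \<open>L \<omega> > 0\<close>
      by (simp add: Y h ennreal_of_nat_eq_real_of_nat inf_absorb1)
  qed
  let ?N = "\<integral>\<^sup>+\<omega>. inf (h \<omega>) (of_nat k) \<partial>M"
  have "?N \<le> (\<integral>\<^sup>+\<omega>. of_nat k \<partial>M)" by (intro nn_integral_mono) simp
  also have "\<dots> < top" by (simp add: emeasure_space_1 ennreal_of_nat_eq_real_of_nat)
  finally have N: "?N < top" .
  hence Pfin: "P < top" using k by (meson less_trans)
  have int: "integrable M Y"
    using N Pfin by (simp add: real_integrable_def pos negp P_def less_top)
  have "expectation Y = enn2real P - enn2real ?N"
    by (simp add: real_lebesgue_integral_def[OF int] pos negp P_def)
  also have "\<dots> < 0" using k N Pfin by (simp add: enn2real_less_iff)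
  finally show thesis using that[of k] int unfolding Y_def by blast
qed

lemma mat_prod_cong: "(\<And>i. i \<in> {1..n} \<Longrightarrow> F i = G i) \<Longrightarrow> mat_prod F n = mat_prod G n"
  by (induction n) auto

lemma measurable_mat_prod:
  "n \<le> m \<Longrightarrow> (\<lambda>F. mat_prod F n :: 'n::finite sqmat) \<in> borel_measurable (PiM {1..m} (\<lambda>_. borel))"
proof (induction n)
  case (Suc n)
  have [measurable]: "(\<lambda>F. mat_prod F n :: 'n sqmat) \<in> borel_measurable (PiM {1..m} (\<lambda>_. borel))"
    using Suc by simp
  have [measurable]: "(\<lambda>F. F (Suc n) :: 'n sqmat) \<in> borel_measurable (PiM {1..m} (\<lambda>_. borel))"
    using Suc.prems by (intro measurable_component_singleton) auto
  show ?case unfolding mat_prod.simps by (rule borel_measurable_matrix_mult) fact+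
qed simp

text \<open>
  In \<open>mat_prod\<close> the new factor is appended on the right, in \<open>affine_power\<close> on the left; associativity
  of the convolution reconciles the two.
\<close>
lemma affine_power_law_mat_prod:
  fixes As :: "nat \<Rightarrow> 'a \<Rightarrow> 'n::finite sqmat"
  assumes M: "prob_space M" and indep: "prob_space.indep_vars M (\<lambda>_. borel) As {1..}"
    and p: "borel_prob p" and law: "\<And>n. n \<ge> 1 \<Longrightarrow> distr M borel (As n) = distr p borel fst"
  shows "(\<lambda>\<omega>. mat_prod (\<lambda>m. As m \<omega>) n) \<in> borel_measurable M \<and>
    distr M borel (\<lambda>\<omega>. mat_prod (\<lambda>m. As m \<omega>) n) = distr (affine_power p n) borel fst"
proof (induction n)
  interpret prob_space M by (rule M)
  have [measurable]: "fst \<in> borel_measurable (borel :: 'n affine measure)"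
    by (simp add: borel_prod[symmetric])
  {
    case 0
    have "distr M borel (\<lambda>\<omega>. mat 1) = return borel (mat 1 :: 'n sqmat)"
      by (rule measure_eqI) (auto simp: emeasure_distr emeasure_space_1 split: split_indicator)
    thus ?case by (simp add: distr_return)
  next
    case (Suc n)
    let ?C = "\<lambda>\<omega>. mat_prod (\<lambda>m. As m \<omega>) n"
    let ?R = "affine_power p n"
    have [measurable]: "?C \<in> borel_measurable M" using Suc by blast
    have As [measurable]: "As (Suc n) \<in> borel_measurable M"
      using indep unfolding indep_vars_def by simp
    have [measurable_cong]: "sets p = sets borel" "sets ?R = sets borel"
      using p borel_prob_affine_power[OF p] by auto
    have "indep_var (PiM {1..n} (\<lambda>_. borel)) (\<lambda>\<omega>. restrict (\<lambda>i. As i \<omega>) {1..n})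
        (PiM {Suc n} (\<lambda>_. borel)) (\<lambda>\<omega>. restrict (\<lambda>i. As i \<omega>) {Suc n})"
      by (rule indep_var_restrict[OF indep]) auto
    hence "indep_var borel ((\<lambda>F. mat_prod F n) \<circ> (\<lambda>\<omega>. restrict (\<lambda>i. As i \<omega>) {1..n}))
        borel ((\<lambda>F. F (Suc n)) \<circ> (\<lambda>\<omega>. restrict (\<lambda>i. As i \<omega>) {Suc n}))"
      by (rule indep_var_compose)
         (rule measurable_mat_prod[OF order_refl], rule measurable_component_singleton, simp)
    also have "(\<lambda>F. mat_prod F n) \<circ> (\<lambda>\<omega>. restrict (\<lambda>i. As i \<omega>) {1..n}) = ?C"
      by (auto simp: fun_eq_iff intro!: mat_prod_cong)
    also have "(\<lambda>F. F (Suc n)) \<circ> (\<lambda>\<omega>. restrict (\<lambda>i. As i \<omega>) {Suc n}) = As (Suc n)"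
      by (simp add: fun_eq_iff)
    finally have "indep_var borel ?C borel (As (Suc n))" .
    hence joint: "distr M borel ?C \<Otimes>\<^sub>M distr M borel (As (Suc n)) =
        distr M (borel \<Otimes>\<^sub>M borel) (\<lambda>\<omega>. (?C \<omega>, As (Suc n) \<omega>))"
      by (simp add: indep_var_distribution_eq)
    have one: "affine_power p 1 = p" by (simp add: affine_conv_one p)
    have "distr M borel (\<lambda>\<omega>. ?C \<omega> ** As (Suc n) \<omega>) = distr (affine_power p (Suc n)) borel fst"
    proof (rule borel_prob_eqI)
      fix f :: "'n sqmat \<Rightarrow> ennreal" assume f [measurable]: "f \<in> borel_measurable borel"
      interpret Lp: prob_space "distr p borel fst"
        using p by (intro prob_space.prob_space_distr) auto
      have "(\<integral>\<^sup>+x. f x \<partial>distr M borel (\<lambda>\<omega>. ?C \<omega> ** As (Suc n) \<omega>)) =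
          (\<integral>\<^sup>+\<omega>. f (?C \<omega> ** As (Suc n) \<omega>) \<partial>M)"
        by (rule nn_integral_distr) measurable
      also have "\<dots> = (\<integral>\<^sup>+x. f (fst x ** snd x) \<partial>distr M (borel \<Otimes>\<^sub>M borel) (\<lambda>\<omega>. (?C \<omega>, As (Suc n) \<omega>)))"
        by (subst nn_integral_distr) auto
      also have "\<dots> = (\<integral>\<^sup>+x. f (fst x ** snd x) \<partial>(distr ?R borel fst \<Otimes>\<^sub>M distr p borel fst))"
        using Suc law[of "Suc n"] by (simp add: joint[symmetric])
      also have "\<dots> = (\<integral>\<^sup>+c. \<integral>\<^sup>+a. f (c ** a) \<partial>distr p borel fst \<partial>distr ?R borel fst)"
        by (subst Lp.nn_integral_fst[symmetric]) auto
      also have "\<dots> = (\<integral>\<^sup>+g. \<integral>\<^sup>+h. f (fst (affine_comp g h)) \<partial>p \<partial>?R)"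
      proof -
        have "(\<lambda>c. \<integral>\<^sup>+a. f (c ** fst a) \<partial>p) \<in> borel_measurable borel"
          by (rule borel_measurable_nn_integral_borel[OF p]) measurable
        thus ?thesis by (simp add: nn_integral_distr affine_comp_def)
      qed
      also have "\<dots> = (\<integral>\<^sup>+x. f (fst x) \<partial>affine_conv ?R (affine_power p 1))"
        unfolding one by (rule nn_integral_affine_conv[symmetric, OF borel_prob_affine_power[OF p] p]) measurable
      also have "affine_conv ?R (affine_power p 1) = affine_power p (Suc n)"
        using affine_power_add[OF p, of n 1] by simp
      also have "(\<integral>\<^sup>+x. f (fst x) \<partial>\<dots>) = (\<integral>\<^sup>+x. f x \<partial>distr (affine_power p (Suc n)) borel fst)"
      proof -
        have [measurable_cong]: "sets (affine_power p (Suc n)) = sets borel"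
          using borel_prob_affine_power[OF p] by blast
        show ?thesis by (rule nn_integral_distr[symmetric]) measurable
      qed
      finally show "(\<integral>\<^sup>+x. f x \<partial>distr M borel (\<lambda>\<omega>. ?C \<omega> ** As (Suc n) \<omega>)) =
          (\<integral>\<^sup>+x. f x \<partial>distr (affine_power p (Suc n)) borel fst)" .
    qed auto
    thus ?case by simp
  }
qed

lemma affine_power_mult:
  assumes p: "borel_prob p"
  shows "affine_power (affine_power p n) m = affine_power p (m * n)"
  by (induction m) (simp_all add: affine_power_add p)

text \<open>
  Some \<open>n\<close> makes the expected logarithm of the norm of a product of \<open>n\<close> factors negative. Long products
  are then cut into blocks of \<open>n\<close> factors, that is, the tail estimate is applied to
  \<open>affine_power p n\<close> in place of \<open>p\<close>.
\<close>
lemma negative_lyapunov_contracts: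
  fixes As :: "nat \<Rightarrow> 'a \<Rightarrow> 'n::finite sqmat"
  assumes M: "prob_space M" and indep: "prob_space.indep_vars M (\<lambda>_. borel) As {1..}"
    and p: "borel_prob p" and law: "\<And>n. n \<ge> 1 \<Longrightarrow> distr M borel (As n) = distr p borel fst"
    and neg: "lyapunov M As < 0" and "\<epsilon> > 0"
  shows "\<exists>n. emeasure (affine_power p n) {g. exp \<tau> < sq_op_norm (fst g)} < ennreal \<epsilon>"
proof -
  interpret prob_space M by (rule M)
  have [measurable]: "fst \<in> borel_measurable (borel :: 'n affine measure)"
    by (simp add: borel_prod[symmetric])
  let ?C = "\<lambda>n \<omega>. mat_prod (\<lambda>m. As m \<omega>) n"
  obtain n where n: "n \<ge> 1" "ereal (1 / real n) * eexpectation M (\<lambda>\<omega>. elog (sq_op_norm (?C n \<omega>))) < 0"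
    using neg unfolding lyapunov_def sq_op_norm_def[symmetric] by (auto simp: INF_less_iff)
  have "eexpectation M (\<lambda>\<omega>. elog (sq_op_norm (?C n \<omega>))) < 0"
  proof (rule ccontr)
    assume "\<not> ?thesis"
    hence "0 \<le> ereal (1 / real n) * eexpectation M (\<lambda>\<omega>. elog (sq_op_norm (?C n \<omega>)))"
      by (intro ereal_0_le_mult) auto
    thus False using n(2) by simp
  qed
  note E = this
  have C [measurable]: "?C n \<in> borel_measurable M"
    and Claw: "distr M borel (?C n) = distr (affine_power p n) borel fst"
    using affine_power_law_mat_prod[OF M indep p law] by blast+
  have "(\<lambda>\<omega>. sq_op_norm (?C n \<omega>)) \<in> borel_measurable M" by measurable
  then obtain k :: nat where k: "integrable M (\<lambda>\<omega>. ln (max (sq_op_norm (?C n \<omega>)) (exp (- real k))))"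
    "expectation (\<lambda>\<omega>. ln (max (sq_op_norm (?C n \<omega>)) (exp (- real k)))) < 0"
    using truncated_log_expectation_neg[OF _ E] by blast
  define \<phi> where "\<phi> c = ln (max (sq_op_norm c) (exp (- real k)))" for c :: "'n sqmat"
  have [measurable]: "\<phi> \<in> borel_measurable borel" unfolding \<phi>_def by measurable
  let ?q = "affine_power p n"
  have q: "borel_prob ?q" by (rule borel_prob_affine_power[OF p])
  have [measurable_cong]: "sets ?q = sets borel" using q by simp
  have "integrable (distr M borel (?C n)) \<phi>" "(\<integral>c. \<phi> c \<partial>distr M borel (?C n)) < 0"
    using k by (simp_all add: integrable_distr_eq integral_distr \<phi>_def)
  hence "integrable ?q (\<lambda>g. \<phi> (fst g))" "(\<integral>g. \<phi> (fst g) \<partial>?q) < 0"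
    unfolding Claw by (simp_all add: integrable_distr_eq integral_distr)
  moreover have "sq_op_norm (fst g) \<le> exp (\<phi> (fst g))" for g :: "'n affine"
  proof -
    have "0 < max (sq_op_norm (fst g)) (exp (- real k))" by (simp add: less_max_iff_disj)
    thus ?thesis by (simp add: \<phi>_def)
  qed
  ultimately show ?thesis
    using affine_power_contracts[OF q, of "\<lambda>g. \<phi> (fst g)" \<epsilon> \<tau>] \<open>\<epsilon> > 0\<close>
    by (auto simp: affine_power_mult p)
qed

section \<open>Independence of variables with different value types\<close>

lemma indep_rv_joint_law:
  fixes Y :: "'a \<Rightarrow> 'b::topological_space" and Z :: "'a \<Rightarrow> 'c::topological_space"
  assumes M: "prob_space M" and ind: "indep_rv M Y Z"
  shows "distr M borel Y \<Otimes>\<^sub>M distr M borel Z = distr M (borel \<Otimes>\<^sub>M borel) (\<lambda>\<omega>. (Y \<omega>, Z \<omega>))"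
proof (rule pair_measure_eqI)
  interpret prob_space M by (rule M)
  have [measurable]: "Y \<in> borel_measurable M" "Z \<in> borel_measurable M"
    using ind by (auto simp: indep_rv_def)
  interpret Y: prob_space "distr M borel Y" by (rule prob_space_distr) simp
  interpret Z: prob_space "distr M borel Z" by (rule prob_space_distr) simp
  show "sigma_finite_measure (distr M borel Y)" "sigma_finite_measure (distr M borel Z)"
    by unfold_locales
  fix S T assume ST: "S \<in> sets (distr M borel Y)" "T \<in> sets (distr M borel Z)"
  hence [measurable]: "S \<in> sets borel" "T \<in> sets borel" by auto
  have "prob ((Y -` S \<inter> space M) \<inter> (Z -` T \<inter> space M)) =
      prob (Y -` S \<inter> space M) * prob (Z -` T \<inter> space M)"
    using ind ST unfolding indep_rv_def by (intro indep_setD) auto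
  moreover have "(\<lambda>\<omega>. (Y \<omega>, Z \<omega>)) -` (S \<times> T) \<inter> space M =
      (Y -` S \<inter> space M) \<inter> (Z -` T \<inter> space M)" by auto
  ultimately show "emeasure (distr M borel Y) S * emeasure (distr M borel Z) T =
      emeasure (distr M (borel \<Otimes>\<^sub>M borel) (\<lambda>\<omega>. (Y \<omega>, Z \<omega>))) (S \<times> T)"
    by (simp add: emeasure_distr emeasure_eq_measure ennreal_mult)
qed (simp_all cong: sets_pair_measure_cong)

lemma vimage_compose_subset:
  fixes h :: "'b::topological_space \<Rightarrow> 'c::topological_space" and W :: "'a \<Rightarrow> 'b"
  assumes "h \<in> borel_measurable borel"
  shows "{(\<lambda>\<omega>. h (W \<omega>)) -` S \<inter> A | S. S \<in> sets borel} \<subseteq> {W -` S \<inter> A | S. S \<in> sets borel}"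
proof safe
  fix S :: "'c set" assume "S \<in> sets borel"
  hence "h -` S \<in> sets borel" using measurable_sets[OF assms, of S] by simp
  thus "\<exists>T. (\<lambda>\<omega>. h (W \<omega>)) -` S \<inter> A = W -` T \<inter> A \<and> T \<in> sets borel"
    by (intro exI[of _ "h -` S"]) auto
qed

lemma indep_rv_compose:
  assumes M: "prob_space M" and ind: "indep_rv M Y Z"
    and f: "f \<in> borel_measurable borel" and g: "g \<in> borel_measurable borel"
  shows "indep_rv M (\<lambda>\<omega>. f (Y \<omega>)) (\<lambda>\<omega>. g (Z \<omega>))"
proof -
  interpret prob_space M by (rule M)
  have Y: "Y \<in> borel_measurable M" and Z: "Z \<in> borel_measurable M"
    and ind': "indep_set {Y -` S \<inter> space M | S. S \<in> sets borel} {Z -` S \<inter> space M | S. S \<in> sets borel}"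
    using ind by (auto simp: indep_rv_def)
  have "indep_set {(\<lambda>\<omega>. f (Y \<omega>)) -` S \<inter> space M | S. S \<in> sets borel}
      {(\<lambda>\<omega>. g (Z \<omega>)) -` S \<inter> space M | S. S \<in> sets borel}"
  proof (rule indep_setI)
    show "{(\<lambda>\<omega>. f (Y \<omega>)) -` S \<inter> space M | S. S \<in> sets borel} \<subseteq> events"
      using vimage_compose_subset[OF f] indep_setD_ev1[OF ind'] by (rule order_trans)
    show "{(\<lambda>\<omega>. g (Z \<omega>)) -` S \<inter> space M | S. S \<in> sets borel} \<subseteq> events"
      using vimage_compose_subset[OF g] indep_setD_ev2[OF ind'] by (rule order_trans)
    show "prob (a \<inter> b) = prob a * prob b"
      if "a \<in> {(\<lambda>\<omega>. f (Y \<omega>)) -` S \<inter> space M | S. S \<in> sets borel}"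
        "b \<in> {(\<lambda>\<omega>. g (Z \<omega>)) -` S \<inter> space M | S. S \<in> sets borel}" for a b
      using subsetD[OF vimage_compose_subset[OF f] that(1)] subsetD[OF vimage_compose_subset[OF g] that(2)] by (rule indep_setD[OF ind'])
  qed
  thus ?thesis using measurable_compose[OF Y f] measurable_compose[OF Z g]
    by (simp add: indep_rv_def)
qed

section \<open>Compression of a fixed law\<close>

lemma affine_push_law:
  fixes G :: "'a \<Rightarrow> 'n::finite affine" and X :: "'a \<Rightarrow> 'n sqmat"
  assumes M: "prob_space M" and ind: "indep_rv M G X"
  shows "affine_push (distr M borel G) (distr M borel X) = distr M borel (\<lambda>\<omega>. affine_map (G \<omega>) (X \<omega>))"
proof -
  have [measurable]: "G \<in> borel_measurable M" "X \<in> borel_measurable M"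
    using ind by (auto simp: indep_rv_def)
  have "(\<lambda>(g, z). affine_map g z) \<in> borel_measurable (borel \<Otimes>\<^sub>M (borel :: 'n sqmat measure))"
    by (intro measurable_pair_borel) auto
  thus ?thesis
    by (simp add: affine_push_def indep_rv_joint_law[OF M ind] distr_distr o_def)
qed

text \<open>
  The matrix \<open>J A\<close> has the Gram matrix \<open>S = J A A\<^sup>T J\<^sup>T\<close>, and so has \<open>S\<^sup>1\<^sup>/\<^sup>2 J\<close> because \<open>J J\<^sup>T = 1\<close>. For an
  invariant law of \<open>X\<close> independent of \<open>(A, B)\<close> one may therefore replace \<open>J A\<close> by \<open>S\<^sup>1\<^sup>/\<^sup>2 J\<close> in
  \<open>J (A X A\<^sup>T + B) J\<^sup>T = (J A) X (J A)\<^sup>T + J B J\<^sup>T\<close>, first for fixed values of \<open>(A, B)\<close> and then by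
  integration.
\<close>
lemma fixed_point_compression:
  fixes A B X :: "'a \<Rightarrow> 'n::finite sqmat" and J :: "real^'n^'k"
  assumes M: "prob_space M" and ind: "indep_rv M (\<lambda>\<omega>. (A \<omega>, B \<omega>)) X"
    and A [measurable]: "A \<in> borel_measurable M" and B [measurable]: "B \<in> borel_measurable M"
    and fixed: "distr M borel (\<lambda>\<omega>. affine_map (A \<omega>, B \<omega>) (X \<omega>)) = distr M borel X"
    and inv: "orth_invariant (distr M borel X)" and J: "J ** transpose J = mat 1"
  shows "distr M borel (\<lambda>\<omega>. congr J (X \<omega>)) =
    distr M borel (\<lambda>\<omega>. psd_sqrt (congr J (A \<omega> ** transpose (A \<omega>))) ** congr J (X \<omega>)
      ** psd_sqrt (congr J (A \<omega> ** transpose (A \<omega>))) + congr J (B \<omega>))"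
    (is "_ = distr M borel ?Z")
proof -
  have X [measurable]: "X \<in> borel_measurable M" using ind by (simp add: indep_rv_def)
  have G [measurable]: "(\<lambda>\<omega>. (A \<omega>, B \<omega>)) \<in> borel_measurable M" using ind by (simp add: indep_rv_def)
  let ?p = "distr M borel (\<lambda>\<omega>. (A \<omega>, B \<omega>))" and ?\<mu> = "distr M borel X"
  have p: "borel_prob ?p" and \<mu>: "borel_prob ?\<mu>"
    by (rule borel_prob_distr[OF M], measurable)+
  interpret \<mu>: prob_space ?\<mu> using \<mu> by simp
  have [measurable]: "fst \<in> borel_measurable (borel :: 'n affine measure)"
    "snd \<in> borel_measurable (borel :: 'n affine measure)"
    by (simp_all add: borel_prod[symmetric])
  define S where "S g = congr J (fst g ** transpose (fst g))" for g :: "'n affine"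
  have [measurable]: "S \<in> borel_measurable borel" unfolding S_def by measurable
  have S_gram: "S g = (J ** fst g) ** transpose (J ** fst g)" for g
    by (simp add: S_def congr_def matrix_transpose_mul matrix_mul_assoc)
  have psd: "pos_semidef (S g)" for g
    unfolding S_gram by (rule pos_semidef_gram)
  have gram: "(psd_root (S g) ** J) ** transpose (psd_root (S g) ** J) = (J ** fst g) ** transpose (J ** fst g)" for g
  proof -
    have "(psd_root (S g) ** J) ** transpose (psd_root (S g) ** J) =
        psd_root (S g) ** (J ** transpose J) ** transpose (psd_root (S g))"
      by (simp add: matrix_transpose_mul matrix_mul_assoc)
    thus ?thesis using psd_root_gram[OF psd[of g]] by (simp add: J S_gram)
  qed
  have root: "congr (psd_root (S g) ** J) x = psd_sqrt (S g) ** congr J x ** psd_sqrt (S g)" for g x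
    using psd_sqrt(1)[OF psd[of g]] psd[of g]
    by (simp add: congr_mult congr_def[of "psd_sqrt (S g)"] psd_root_def)
       (simp add: pos_semidef_def)
  have Z: "?Z \<omega> = congr (psd_root (S (A \<omega>, B \<omega>)) ** J) (X \<omega>) + congr J (B \<omega>)" for \<omega>
    by (simp add: root) (simp add: S_def)
  have Zm: "?Z \<in> borel_measurable M" unfolding Z by measurable
  show ?thesis
  proof (rule borel_prob_eqI)
    fix f :: "'k sqmat \<Rightarrow> ennreal" assume f [measurable]: "f \<in> borel_measurable borel"
    have "(\<integral>\<^sup>+x. f x \<partial>distr M borel ?Z) =
        (\<integral>\<^sup>+\<omega>. f (congr (psd_root (S (A \<omega>, B \<omega>)) ** J) (X \<omega>) + congr J (B \<omega>)) \<partial>M)"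
      using Zm by (subst nn_integral_distr) (simp_all add: Z[symmetric])
    also have "\<dots> = (\<integral>\<^sup>+y. f (congr (psd_root (S (fst y)) ** J) (snd y) + congr J (snd (fst y))) \<partial>(?p \<Otimes>\<^sub>M ?\<mu>))"
      unfolding indep_rv_joint_law[OF M ind] by (subst nn_integral_distr) auto
    also have "\<dots> = (\<integral>\<^sup>+g. \<integral>\<^sup>+z. f (congr (psd_root (S g) ** J) z + congr J (snd g)) \<partial>?\<mu> \<partial>?p)"
      by (subst \<mu>.nn_integral_fst[symmetric]) auto
    also have "\<dots> = (\<integral>\<^sup>+g. \<integral>\<^sup>+z. f (congr (J ** fst g) z + congr J (snd g)) \<partial>?\<mu> \<partial>?p)"
    proof (rule nn_integral_cong)
      fix g :: "'n affine"
      have "(\<lambda>y. f (y + congr J (snd g))) \<in> borel_measurable borel" by measurable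
      from orth_invariant_equal_gram[OF \<mu> inv gram this]
      show "(\<integral>\<^sup>+z. f (congr (psd_root (S g) ** J) z + congr J (snd g)) \<partial>?\<mu>) =
        (\<integral>\<^sup>+z. f (congr (J ** fst g) z + congr J (snd g)) \<partial>?\<mu>)" .
    qed
    also have "\<dots> = (\<integral>\<^sup>+x. f (congr J x) \<partial>affine_push ?p ?\<mu>)"
      by (subst nn_integral_affine_push[OF p \<mu>]) (simp_all add: affine_map_def congr_add congr_mult)
    also have "affine_push ?p ?\<mu> = ?\<mu>"
      using affine_push_law[OF M ind] fixed by simp
    also have "(\<integral>\<^sup>+x. f (congr J x) \<partial>?\<mu>) = (\<integral>\<^sup>+x. f x \<partial>distr M borel (\<lambda>\<omega>. congr J (X \<omega>)))"
      by (simp add: nn_integral_distr)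
    finally show "(\<integral>\<^sup>+x. f x \<partial>distr M borel (\<lambda>\<omega>. congr J (X \<omega>))) = (\<integral>\<^sup>+x. f x \<partial>distr M borel ?Z)"
      by simp
  qed auto
qed

text \<open>
  Passing to a principal submatrix is a congruence by a matrix with orthonormal rows.
\<close>
lemma selection_matrix:
  fixes s :: "'k::finite \<Rightarrow> 'n::finite"
  defines "J \<equiv> (\<chi> i j. if j = s i then 1 else 0) :: real^'n^'k"
  shows congr_selection: "congr J x = (\<chi> i j. x $ s i $ s j)"
    and selection_isometry: "inj s \<Longrightarrow> J ** transpose J = mat 1"
proof -
  have Jx: "(J ** x) $ i $ j = x $ s i $ j" for x :: "'n sqmat" and i j
  proof -
    have "(J ** x) $ i $ j = (\<Sum>l\<in>UNIV. (if l = s i then 1 else 0) * x $ l $ j)"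
      by (simp add: matrix_matrix_mult_def J_def)
    also have "\<dots> = (\<Sum>l\<in>UNIV. if l = s i then x $ l $ j else 0)"
      by (intro sum.cong) auto
    finally show ?thesis by simp
  qed
  have xJ: "(y ** transpose J) $ i $ j = y $ i $ s j" for y :: "real^'n^'k" and i j
  proof -
    have "(y ** transpose J) $ i $ j = (\<Sum>l\<in>UNIV. y $ i $ l * (if l = s j then 1 else 0))"
      by (simp add: matrix_matrix_mult_def J_def transpose_def)
    also have "\<dots> = (\<Sum>l\<in>UNIV. if l = s j then y $ i $ l else 0)"
      by (intro sum.cong) auto
    finally show ?thesis by simp
  qed
  show "congr J x = (\<chi> i j. x $ s i $ s j)"
    by (simp add: congr_def vec_eq_iff xJ Jx)
  show "J ** transpose J = mat 1" if "inj s"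
    using that by (simp add: vec_eq_iff xJ mat_def) (auto simp: J_def dest: injD)
qed

theorem lemma4p13:
  fixes M :: "'a measure"
    and A B X :: "'a \<Rightarrow> 'n::{finite,linorder} sqmat"
    and As Bs :: "nat \<Rightarrow> 'a \<Rightarrow> 'n sqmat"
  assumes "prob_space M"
    and "A \<in> borel_measurable M" and "B \<in> borel_measurable M" and "X \<in> borel_measurable M"
    and "prob_space.indep_vars M (\<lambda>_. borel) (\<lambda>n \<omega>. (As n \<omega>, Bs n \<omega>)) {1..}"
    and "\<forall>n\<ge>1. eq_distr M (\<lambda>\<omega>. (As n \<omega>, Bs n \<omega>)) (\<lambda>\<omega>. (A \<omega>, B \<omega>))"
    and "eexpectation M (\<lambda>\<omega>. elog_plus (lambda_max (A \<omega> ** transpose (A \<omega>)))) < \<infinity>"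
    and "eexpectation M (\<lambda>\<omega>. elog_plus (lambda_max (B \<omega> ** transpose (B \<omega>)))) < \<infinity>"
    and "lyapunov M As < 0"
    and "\<forall>u. orthogonal_matrix u \<longrightarrow>
           eq_distr M
             (\<lambda>\<omega>. (u ** A \<omega> ** transpose (A \<omega>) ** transpose u, u ** B \<omega> ** transpose u))
             (\<lambda>\<omega>. (A \<omega> ** transpose (A \<omega>), B \<omega>))"
    and "indep_rv M (\<lambda>\<omega>. (A \<omega>, B \<omega>)) X"
    and "eq_distr M X (\<lambda>\<omega>. A \<omega> ** X \<omega> ** transpose (A \<omega>) + B \<omega>)"
  shows
    "(CARD('k::{finite,linorder}) \<le> CARD('n) \<longrightarrow>
        eq_distr M
          (\<lambda>\<omega>. leading_submatrix (X \<omega>) :: 'k sqmat)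
          (\<lambda>\<omega>. psd_sqrt (leading_submatrix (A \<omega> ** transpose (A \<omega>))) ** leading_submatrix (X \<omega>)
                  ** psd_sqrt (leading_submatrix (A \<omega> ** transpose (A \<omega>)))
                + leading_submatrix (B \<omega>)) \<and>
        indep_rv M
          (\<lambda>\<omega>. (leading_submatrix (A \<omega> ** transpose (A \<omega>)) :: 'k sqmat,
                  leading_submatrix (B \<omega>) :: 'k sqmat))
          (\<lambda>\<omega>. leading_submatrix (X \<omega>) :: 'k sqmat)) \<and>
     eq_distr M
       (\<lambda>\<omega>. entry11 (X \<omega>))
       (\<lambda>\<omega>. entry11 (A \<omega> ** transpose (A \<omega>)) * entry11 (X \<omega>) + entry11 (B \<omega>)) \<and>
     indep_rv M
       (\<lambda>\<omega>. (entry11 (A \<omega> ** transpose (A \<omega>)), entry11 (B \<omega>)))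
       (\<lambda>\<omega>. entry11 (X \<omega>))"
proof -
  note M = assms(1) and A [measurable] = assms(2) and B [measurable] = assms(3)
    and X [measurable] = assms(4) and iid = assms(5,6) and ind = assms(11)
  interpret prob_space M by (rule M)
  let ?G = "\<lambda>\<omega>. (A \<omega>, B \<omega>)"
  let ?p = "distr M borel ?G" and ?\<mu> = "distr M borel X"
  have [measurable]: "?G \<in> borel_measurable M" using ind by (simp add: indep_rv_def)
  have [measurable]: "fst \<in> borel_measurable (borel :: 'n affine measure)"
    "snd \<in> borel_measurable (borel :: 'n affine measure)"
    by (simp_all add: borel_prod[symmetric])
  have p: "borel_prob ?p" and \<mu>: "borel_prob ?\<mu>"
    by (rule borel_prob_distr[OF M], measurable)+
  have fixed: "distr M borel (\<lambda>\<omega>. affine_map (A \<omega>, B \<omega>) (X \<omega>)) = ?\<mu>"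
    using assms(12) by (simp add: eq_distr_def affine_map_def congr_def)
  have push: "affine_push ?p ?\<mu> = ?\<mu>"
    using affine_push_law[OF M ind] fixed by simp
  have rot: "distr ?p borel (\<lambda>g. (congr u (fst g ** transpose (fst g)), congr u (snd g))) =
      distr ?p borel (\<lambda>g. (fst g ** transpose (fst g), snd g))" if u: "orthogonal_matrix u" for u
  proof -
    have "distr M borel (\<lambda>\<omega>. (congr u (A \<omega> ** transpose (A \<omega>)), congr u (B \<omega>))) =
        distr M borel (\<lambda>\<omega>. (A \<omega> ** transpose (A \<omega>), B \<omega>))"
      using assms(10) u by (simp add: eq_distr_def congr_def matrix_mul_assoc)
    thus ?thesis by (simp add: distr_distr o_def)
  qed
  have indA: "indep_vars (\<lambda>_. borel) As {1..}"
    using indep_vars_compose2[OF iid(1), of "\<lambda>_. fst" "\<lambda>_. borel"] by simp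
  have lawA: "distr M borel (As n) = distr ?p borel fst" if n: "n \<ge> 1" for n
  proof -
    have [measurable]: "(\<lambda>\<omega>. (As n \<omega>, Bs n \<omega>)) \<in> borel_measurable M"
      using iid(1) n unfolding indep_vars_def by simp
    have "distr M borel (\<lambda>\<omega>. (As n \<omega>, Bs n \<omega>)) = ?p"
      using iid(2) n by (simp add: eq_distr_def)
    hence "distr (distr M borel (\<lambda>\<omega>. (As n \<omega>, Bs n \<omega>))) borel fst = distr ?p borel fst" by simp
    thus ?thesis by (subst (asm) distr_distr) (simp_all add: o_def)
  qed
  have inv: "orth_invariant ?\<mu>"
    using orth_invariant_fixed_point[OF p rot \<mu> push]
      negative_lyapunov_contracts[OF M indA p lawA assms(9)] by blast
  note compression = fixed_point_compression[OF M ind A B fixed inv]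
  have cont_lead: "continuous_on UNIV (leading_submatrix :: 'n sqmat \<Rightarrow> 'k sqmat)"
    unfolding leading_submatrix_def by (intro continuous_intros)
  have cont_11: "continuous_on UNIV (entry11 :: 'n sqmat \<Rightarrow> real)"
    unfolding entry11_def by (intro continuous_intros)
  note meas_lead [measurable] = borel_measurable_continuous_onI[OF cont_lead]
    and meas_11 [measurable] = borel_measurable_continuous_onI[OF cont_11]
  have "eq_distr M
          (\<lambda>\<omega>. leading_submatrix (X \<omega>) :: 'k sqmat)
          (\<lambda>\<omega>. psd_sqrt (leading_submatrix (A \<omega> ** transpose (A \<omega>))) ** leading_submatrix (X \<omega>)
                  ** psd_sqrt (leading_submatrix (A \<omega> ** transpose (A \<omega>)))
                + leading_submatrix (B \<omega>))" if "CARD('k) \<le> CARD('n)"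
  proof -
    have "inj (lead_idx :: 'k \<Rightarrow> 'n)"
      using strict_mono_lead_idx[OF that] by (rule strict_mono_imp_inj_on)
    from compression[OF selection_isometry[OF this]] show ?thesis
      unfolding congr_selection eq_distr_def leading_submatrix_def .
  qed
  moreover have "indep_rv M
          (\<lambda>\<omega>. (leading_submatrix (A \<omega> ** transpose (A \<omega>)) :: 'k sqmat,
                  leading_submatrix (B \<omega>) :: 'k sqmat))
          (\<lambda>\<omega>. leading_submatrix (X \<omega>) :: 'k sqmat)"
  proof -
    have "(\<lambda>g. (leading_submatrix (fst g ** transpose (fst g)) :: 'k sqmat,
        leading_submatrix (snd g) :: 'k sqmat)) \<in> borel_measurable (borel :: 'n affine measure)"
      by measurable
    from indep_rv_compose[OF M ind this meas_lead] show ?thesis by simp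
  qed
  moreover have "eq_distr M (\<lambda>\<omega>. entry11 (X \<omega>))
       (\<lambda>\<omega>. entry11 (A \<omega> ** transpose (A \<omega>)) * entry11 (X \<omega>) + entry11 (B \<omega>))"
  proof -
    \<comment> \<open>The case of a single index, where matrices commute and the root squares to the entry.\<close>
    let ?s = "\<lambda>_::unit. Min UNIV :: 'n"
    let ?J = "(\<chi> i j. if j = ?s i then 1 else 0) :: ((real, 'n) vec, unit) vec"
    let ?S = "\<lambda>\<omega>. congr ?J (A \<omega> ** transpose (A \<omega>))"
    let ?Z = "\<lambda>\<omega>. psd_sqrt (?S \<omega>) ** congr ?J (X \<omega>) ** psd_sqrt (?S \<omega>) + congr ?J (B \<omega>)"
    have e: "congr ?J x $ () $ () = entry11 x" for x
      by (simp add: congr_selection[of ?s] entry11_def)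
    have law: "distr M borel (\<lambda>\<omega>. congr ?J (X \<omega>)) = distr M borel ?Z"
      by (intro compression selection_isometry injI) simp
    have psd: "pos_semidef (?S \<omega>)" for \<omega>
      using pos_semidef_gram[of "?J ** A \<omega>"] by (simp add: congr_def matrix_transpose_mul matrix_mul_assoc)
    have Z: "?Z \<omega> $ () $ () = entry11 (A \<omega> ** transpose (A \<omega>)) * entry11 (X \<omega>) + entry11 (B \<omega>)" for \<omega>
    proof -
      have "psd_sqrt (?S \<omega>) $ () $ () * psd_sqrt (?S \<omega>) $ () $ () = entry11 (A \<omega> ** transpose (A \<omega>))"
        using arg_cong[OF psd_sqrt(2)[OF psd[of \<omega>]], of "\<lambda>x. x $ () $ ()"]
        by (simp add: matrix_matrix_mult_def[of "psd_sqrt _"] UNIV_unit e)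
      thus ?thesis by (simp add: matrix_matrix_mult_def[of "psd_sqrt _"] matrix_matrix_mult_def[of "\<chi> i j. _ i j"] UNIV_unit e mult_ac)
    qed
    have [measurable]: "?Z \<in> borel_measurable M"
    proof -
      have "?Z = (\<lambda>\<omega>. psd_root (?S \<omega>) ** congr ?J (X \<omega>) ** psd_root (?S \<omega>) + congr ?J (B \<omega>))"
        using psd by (simp add: psd_root_def)
      thus ?thesis by (simp only:) measurable
    qed
    have [measurable]: "(\<lambda>y :: unit sqmat. y $ () $ ()) \<in> borel_measurable borel"
      by (intro borel_measurable_continuous_onI continuous_intros)
    have "distr (distr M borel (\<lambda>\<omega>. congr ?J (X \<omega>))) borel (\<lambda>y. y $ () $ ()) =
        distr (distr M borel ?Z) borel (\<lambda>y. y $ () $ ())"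
      by (simp only: law)
    thus ?thesis
      by (simp add: eq_distr_def distr_distr o_def Z e del: vector_add_component)
  qed
  moreover have "indep_rv M (\<lambda>\<omega>. (entry11 (A \<omega> ** transpose (A \<omega>)), entry11 (B \<omega>))) (\<lambda>\<omega>. entry11 (X \<omega>))"
  proof -
    have "(\<lambda>g. (entry11 (fst g ** transpose (fst g)), entry11 (snd g)))
        \<in> borel_measurable (borel :: 'n affine measure)"
      by measurable
    from indep_rv_compose[OF M ind this meas_11] show ?thesis by simp
  qed
  ultimately show ?thesis by blast
qed

end
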